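(* Let $P_n\,\square\, P_n$ be the $n\times n$ square grid. Then $\mathrm{dct}(P_n\,\square\, P_n)=(1+o(1))\frac{3}{8}n$, and the cost of drunkenness is $F(P_n\,\square\,P_n)=8/3+o(1)$, where asymptotics are as $n\to\infty$.
   Context: $P_n$ is the path with vertices $\{0,\dots,n-1\}$ and edges $\{i-1,i\}$. The Cartesian product $G\,\square\,H$ has vertex set $V(G)\times V(H)$, with $(u_1,v_1)$ adjacent to $(u_2,v_2)$ iff either $u_1=u_2$ and $v_1v_2\in E(H)$, or $v_1=v_2$ and $u_1u_2\in E(G)$. Cops and robber game on a finite connected graph $G=(V,E)$ with $k$ cops: in round $0$ the cops choose positions $x\in V^k$, then the robber chooses his initial vertex; in each round $t\ge1$ first each cop moves along an edge or stays, then the robber moves. Capture time is the first time a cop and the robber occupy the same vertex. The cop number $c(G)$ is the minimum $k$ for which the cops can guarantee capture of a robber who sees everything and plays optimally ($c(P_n\,\square\,P_n)=2$). $\mathrm{ct}_{x,y}(G,k)$ is the capture time from $(x,y)$ under optimal play (cops minimizing, robber maximizing); $\mathrm{ct}(G,k)=\min_{x}\max_{y}\mathrm{ct}_{x,y}(G,k)$ and $\mathrm{ct}(G)=\mathrm{ct}(G,c(G))$. In the drunk robber version, after the cops choose $x$ the robber's initial vertex is uniformly random in $V$, and in each round the robber moves to a uniformly random neighbour of his current vertex (open neighbourhood; he never stays), independently of the cops; the cops see him. $\mathrm{dct}_{x,y}(G,k)$ is the expected capture time from $(x,y)$ when the cops play to minimize it, $\mathrm{dct}(G,k)=\min_{x\in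 V^k}\frac{1}{|V|}\sum_{y\in V}\mathrm{dct}_{x,y}(G,k)$, $\mathrm{dct}(G)=\mathrm{dct}(G,c(G))$, and $F(G)=\mathrm{ct}(G)/\mathrm{dct}(G)$. *)

theory Defs
  imports "HOL-Probability.Probability" "Graph_Theory.Pair_Digraph"
begin

text \<open>
  Finite simple graphs are the \<^locale>\<open>pair_graph\<close>s of the theory \<open>Pair_Digraph\<close>: the vertex set is
  \<^const>\<open>pverts\<close>, and an undirected edge \<open>uv\<close> is the pair of arcs \<open>(u, v)\<close>, \<open>(v, u)\<close> in
  \<^const>\<open>parcs\<close>.
\<close>

definition path_graph :: "nat \<Rightarrow> nat pair_pre_digraph" where
  "path_graph n = \<lparr> pverts = {0..<n},
     parcs = {(i, j). i < n \<and> j < n \<and> (j = Suc i \<or> i = Suc j)} \<rparr>"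

definition cartesian_product ::
  "'a pair_pre_digraph \<Rightarrow> 'b pair_pre_digraph \<Rightarrow> ('a \<times> 'b) pair_pre_digraph" where
  "cartesian_product G H = \<lparr> pverts = pverts G \<times> pverts H,
     parcs = {((u1, v1), (u2, v2)).
       (u1 = u2 \<and> u1 \<in> pverts G \<and> (v1, v2) \<in> parcs H) \<or>
       (v1 = v2 \<and> v1 \<in> pverts H \<and> (u1, u2) \<in> parcs G)} \<rparr>"

definition grid :: "nat \<Rightarrow> (nat \<times> nat) pair_pre_digraph" where
  "grid n = cartesian_product (path_graph n) (path_graph n)"

lemma pair_graph_path_graph: "pair_graph (path_graph n)"
proof
  show "finite (parcs (path_graph n))"
    by (rule finite_subset[of _ "{0..<n} \<times> {0..<n}"]) (auto simp: path_graph_def)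
  show "symmetric (with_proj (path_graph n))"
    unfolding symmetric_def with_proj_simps by (auto simp: sym_def path_graph_def)
qed (auto simp: path_graph_def)

lemma pair_graph_cartesian_product:
  assumes "pair_graph G" "pair_graph H"
  shows "pair_graph (cartesian_product G H)"
proof -
  interpret G: pair_graph G by fact
  interpret H: pair_graph H by fact
  have symG: "(v, u) \<in> parcs G" if "(u, v) \<in> parcs G" for u v
    using G.pair_sym_arcs that unfolding symmetric_def with_proj_simps by (auto dest: symD)
  have symH: "(v, u) \<in> parcs H" if "(u, v) \<in> parcs H" for u v
    using H.pair_sym_arcs that unfolding symmetric_def with_proj_simps by (auto dest: symD)
  have sub: "parcs (cartesian_product G H) \<subseteq>
      (pverts G \<times> pverts H) \<times> (pverts G \<times> pverts H)"
    by (auto simp: cartesian_product_def dest: G.wellformed' H.wellformed')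
  show ?thesis
  proof
    show "finite (pverts (cartesian_product G H))"
      by (simp add: cartesian_product_def G.pair_finite_verts H.pair_finite_verts)
    show "finite (parcs (cartesian_product G H))"
      using sub by (rule finite_subset) (simp add: G.pair_finite_verts H.pair_finite_verts)
    show "symmetric (with_proj (cartesian_product G H))"
      unfolding symmetric_def with_proj_simps
      by (auto simp: sym_def cartesian_product_def intro: symG symH)
    show "fst e \<in> pverts (cartesian_product G H)" if "e \<in> parcs (cartesian_product G H)" for e
      using subsetD[OF sub that] by (auto simp: cartesian_product_def)
    show "snd e \<in> pverts (cartesian_product G H)" if "e \<in> parcs (cartesian_product G H)" for e
      using subsetD[OF sub that] by (auto simp: cartesian_product_def)
    show "fst e \<noteq> snd e" if "e \<in> parcs (cartesian_product G H)" for e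
      using that G.pair_no_loops H.pair_no_loops by (fastforce simp: cartesian_product_def)
  qed
qed

corollary pair_graph_grid: "pair_graph (grid n)"
  unfolding grid_def by (intro pair_graph_cartesian_product pair_graph_path_graph)


definition cop_positions :: "'a pair_pre_digraph \<Rightarrow> nat \<Rightarrow> 'a list set" where
  "cop_positions G k = {x. length x = k \<and> set x \<subseteq> pverts G}"

definition stay_or_move :: "'a pair_pre_digraph \<Rightarrow> 'a \<Rightarrow> 'a \<Rightarrow> bool" where
  "stay_or_move G u v \<longleftrightarrow> v = u \<or> (u, v) \<in> parcs G"

text \<open>
  Strategies see the whole past. A cop strategy \<open>\<sigma>\<close> maps the robber's positions
  \<open>[y\<^sub>0, \<dots>, y\<^sub>t\<^sub>-\<^sub>1]\<close> before round \<open>t\<close> to the positions of the cops after their move in round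
  \<open>t\<close>; a robber strategy \<open>\<rho>\<close> maps the cop positions \<open>[x\<^sub>0, \<dots>, x\<^sub>t]\<close> to the robber's position at
  the end of round \<open>t\<close>. A player's own past need not be an argument, as the strategy determines it
  from the past of the opponent.
\<close>

definition cop_strategies :: "'a pair_pre_digraph \<Rightarrow> 'a list \<Rightarrow> ('a list \<Rightarrow> 'a list) set" where
  "cop_strategies G x = {\<sigma>. \<sigma> [] = x \<and> (\<forall>h y. list_all2 (stay_or_move G) (\<sigma> h) (\<sigma> (h @ [y])))}"

definition robber_strategies :: "'a pair_pre_digraph \<Rightarrow> ('a list list \<Rightarrow> 'a) set" where
  "robber_strategies G = {\<rho>. (\<forall>x. \<rho> [x] \<in> pverts G) \<and>
     (\<forall>h x. h \<noteq> [] \<longrightarrow> stay_or_move G (\<rho> h) (\<rho> (h @ [x])))}"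

definition cop_trajectory :: "('a list \<Rightarrow> 'a list) \<Rightarrow> (nat \<Rightarrow> 'a) \<Rightarrow> nat \<Rightarrow> 'a list" where
  "cop_trajectory \<sigma> Y t = \<sigma> (map Y [0..<t])"

text \<open>
  The robber's positions when \<open>\<sigma>\<close> is played against \<open>\<rho>\<close>; the inner list is the list of the values
  of \<^const>\<open>cop_trajectory\<close> in rounds \<open>0, \<dots>, t\<close>.
\<close>

function robber_trajectory :: "('a list \<Rightarrow> 'a list) \<Rightarrow> ('a list list \<Rightarrow> 'a) \<Rightarrow> nat \<Rightarrow> 'a" where
  "robber_trajectory \<sigma> \<rho> t =
     \<rho> (map (\<lambda>s. \<sigma> (map (robber_trajectory \<sigma> \<rho>) [0..<s])) [0..<Suc t])"
  by auto
termination by (relation "Wellfounded.measure (\<lambda>(_, _, t). t)") auto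

declare robber_trajectory.simps [simp del]

text \<open>
  The round of the capture, \<open>\<infinity>\<close> if there is none. In round \<open>t\<close> capture happens either by the cops'
  move, while the robber is still at \<open>Y (t - 1)\<close>, or by the robber moving onto a cop.
\<close>

definition capture_time :: "(nat \<Rightarrow> 'a list) \<Rightarrow> (nat \<Rightarrow> 'a) \<Rightarrow> enat" where
  "capture_time X Y =
     (INF t \<in> {t. Y t \<in> set (X t) \<or> (t > 0 \<and> Y (t - 1) \<in> set (X t))}. enat t)"

definition game_capture_time :: "('a list \<Rightarrow> 'a list) \<Rightarrow> ('a list list \<Rightarrow> 'a) \<Rightarrow> enat" where
  "game_capture_time \<sigma> \<rho> =
     (let Y = robber_trajectory \<sigma> \<rho> in capture_time (cop_trajectory \<sigma> Y) Y)"

definition cop_number :: "'a pair_pre_digraph \<Rightarrow> nat" where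
  "cop_number G = (LEAST k. \<exists>x\<in>cop_positions G k. \<exists>\<sigma>\<in>cop_strategies G x.
     \<forall>\<rho>\<in>robber_strategies G. game_capture_time \<sigma> \<rho> < \<infinity>)"

text \<open>The number of cops is the length of \<open>x\<close>.\<close>

definition ct_from :: "'a pair_pre_digraph \<Rightarrow> 'a list \<Rightarrow> 'a \<Rightarrow> enat" where
  "ct_from G x y = (INF \<sigma>\<in>cop_strategies G x. SUP \<rho>\<in>{\<rho>\<in>robber_strategies G. \<rho> [x] = y}.
     game_capture_time \<sigma> \<rho>)"

definition ct_k :: "'a pair_pre_digraph \<Rightarrow> nat \<Rightarrow> enat" where
  "ct_k G k = (INF x\<in>cop_positions G k. SUP y\<in>pverts G. ct_from G x y)"

definition ct :: "'a pair_pre_digraph \<Rightarrow> enat" where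
  "ct G = ct_k G (cop_number G)"

text \<open>
  The law of the simple random walk on \<open>G\<close> started at \<open>y\<close>, as a measure on trajectories: the
  Ionescu-Tulcea limit of the transition kernels, where \<open>walk_kernel G y t Y\<close> is the law of the
  position at time \<open>t\<close> given the earlier positions \<open>Y 0, \<dots>, Y (t - 1)\<close>.
\<close>

definition walk_kernel :: "'a pair_pre_digraph \<Rightarrow> 'a \<Rightarrow> nat \<Rightarrow> (nat \<Rightarrow> 'a) \<Rightarrow> 'a measure" where
  "walk_kernel G y t Y = measure_pmf
     (case t of 0 \<Rightarrow> return_pmf y | Suc s \<Rightarrow> pmf_of_set {v. (Y s, v) \<in> parcs G})"

lemma Ionescu_Tulcea_walk_kernel:
  "Ionescu_Tulcea (walk_kernel G y) (\<lambda>_. count_space UNIV)"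
proof (rule Ionescu_Tulcea.intro)
  fix t
  show "walk_kernel G y t \<in>
      measurable (PiM {0..<t} (\<lambda>_. count_space UNIV)) (subprob_algebra (count_space UNIV))"
  proof (cases t)
    case 0
    then show ?thesis
      by (simp add: walk_kernel_def[abs_def] space_subprob_algebra prob_space_imp_subprob_space
          measure_pmf.prob_space_axioms)
  next
    case (Suc s)
    have "(\<lambda>u. measure_pmf (pmf_of_set {v. (u, v) \<in> parcs G})) \<in>
        measurable (count_space UNIV) (subprob_algebra (count_space UNIV))"
      by (simp add: space_subprob_algebra prob_space_imp_subprob_space
          measure_pmf.prob_space_axioms)
    from measurable_compose[OF measurable_component_singleton[of s "{0..<t}"] this]
    show ?thesis using Suc by (simp add: walk_kernel_def[abs_def])
  qed
qed (simp add: walk_kernel_def measure_pmf.prob_space_axioms)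

definition random_walk :: "'a pair_pre_digraph \<Rightarrow> 'a \<Rightarrow> (nat \<Rightarrow> 'a) measure" where
  "random_walk G y = projective_family.lim UNIV
     (Ionescu_Tulcea.CI (walk_kernel G y) (\<lambda>_. count_space UNIV)) (\<lambda>_. count_space UNIV)"

definition dct_from :: "'a pair_pre_digraph \<Rightarrow> 'a list \<Rightarrow> 'a \<Rightarrow> ennreal" where
  "dct_from G x y = (INF \<sigma>\<in>cop_strategies G x.
     \<integral>\<^sup>+ Y. ennreal_of_enat (capture_time (cop_trajectory \<sigma> Y) Y) \<partial>random_walk G y)"

definition dct_k :: "'a pair_pre_digraph \<Rightarrow> nat \<Rightarrow> ennreal" where
  "dct_k G k = (INF x\<in>cop_positions G k.
     (\<Sum>y\<in>pverts G. dct_from G x y) / of_nat (card (pverts G)))"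

definition dct :: "'a pair_pre_digraph \<Rightarrow> ennreal" where
  "dct G = dct_k G (cop_number G)"

definition cost_of_drunkenness :: "'a pair_pre_digraph \<Rightarrow> ennreal" where
  "cost_of_drunkenness G = ennreal_of_enat (ct G) / dct G"

end

theory Submission
  imports Defs "HOL-Real_Asymp.Real_Asymp"
begin

text \<open>
  The capture time is n up to an additive constant. For the upper bound two cops start next to the
  centre on vertices of opposite parity, and each reduces the larger coordinate difference to the
  robber in every round. After about n rounds both are within distance 1 of the robber, and by
  parity one of them has caught him. For the lower bound the robber evades the first cop on a
  4-cycle in the corner farthest from the second one, who needs about n rounds to get there.

  The drunk robber stays within distance o(n) of his initial vertex y for a linear number of
  rounds, since his mean squared displacement is at most the number of rounds. Hence no strategy
  beats the distance from y to the nearest cop by more than o(n). Conversely, the nearest cop can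
  walk to y and then chase: the distance never increases and drops by 2 with probability at least
  1/4 in every round, so that the chase takes o(n) expected rounds. It remains to minimise the
  average distance to the nearest of two centres, which gives 3n/8.
\<close>

section \<open>The law of the random walk\<close>

text \<open>Walking to y before chasing is what gives the distance the coefficient 1: the chase
  gains only 1/2 per round on average, so from the start this argument would bound the time by twice
  the distance. After the walk only the displacement of the robber, of order sqrt n, is paid for at
  the double rate. The lower bound must hold for every strategy, and the moment of capture may
  depend on the path, so the displacement has to be controlled at all times at once. Instead of a
  maximal inequality, the walk is sampled every L rounds and the displacements at these times are
  added up. This costs L + (n / L) sqrt n up to constants, and L = n^(3/4) balances the two terms.
  The constant 3/8 comes from centres at (n/4, n/2) and (3n/4, n/2): a vertex is on average n/8 away
  horizontally and n/4 vertically. For the optimality of this pair, row sums are replaced by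
  quadratic polynomials up to O(n), and completing squares finishes the argument.\<close>

lemma nn_integral_random_walk_Suc:
  fixes F :: "(nat \<Rightarrow> 'a) \<Rightarrow> ennreal"
  assumes F: "F \<in> borel_measurable (PiM {0..<Suc n} (\<lambda>_. count_space UNIV))"
  shows "(\<integral>\<^sup>+Y. F (restrict Y {0..<Suc n}) \<partial>random_walk G y) =
    (\<integral>\<^sup>+Y. (\<integral>\<^sup>+v. F ((restrict Y {0..<n})(n := v)) \<partial>walk_kernel G y n (restrict Y {0..<n})) \<partial>random_walk G y)"
proof -
  interpret IT: Ionescu_Tulcea "walk_kernel G y" "\<lambda>_. count_space UNIV"
    by (rule Ionescu_Tulcea_walk_kernel)
  \<comment> \<open>\<open>CI J\<close> is a marginal of the iterated kernel \<open>C\<close> run up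
    to a time that bounds J; for an initial segment this time is its length, and nothing is
    projected away.\<close>
  have up: "IT.up_to {0..<m} = m" for m
    unfolding IT.up_to_def by (rule Least_equality) (auto simp: not_less[symmetric])
  have CI: "IT.CI {0..<m} = IT.C 0 m (\<lambda>x. undefined)" for m
    using IT.distr_C[of m m "\<lambda>x. undefined" 0] by (simp add: IT.CI_def up)
  have lim: "(\<integral>\<^sup>+Y. H (restrict Y {0..<m}) \<partial>random_walk G y) = (\<integral>\<^sup>+Y. H Y \<partial>IT.C 0 m (\<lambda>x. undefined))"
    if "H \<in> borel_measurable (PiM {0..<m} (\<lambda>_. count_space UNIV))" for H :: "(nat \<Rightarrow> 'a) \<Rightarrow> ennreal" and m
    unfolding CI[symmetric] random_walk_def using that
    by (subst IT.distr_lim[symmetric]) (auto simp del: restrict_apply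
       intro!: nn_integral_distr[symmetric] measurable_restrict_subset
       simp: measurable_cong_sets[OF IT.PF.sets_lim refl])
  let ?u = "\<lambda>x::nat. undefined :: 'a"
  have sp: "?u \<in> space (PiM {0..<0} (\<lambda>_. count_space UNIV))" by (simp add: space_PiM)
  define H where "H Y = (\<integral>\<^sup>+v. F (Y(n := v)) \<partial>walk_kernel G y n Y)" for Y
  have H: "H \<in> borel_measurable (PiM {0..<n} (\<lambda>_. count_space UNIV))"
  proof -
    have "(\<lambda>Y. \<integral>\<^sup>+x. F x \<partial>IT.eP n Y) \<in> borel_measurable (PiM {0..<n} (\<lambda>_. count_space UNIV))"
      using IT.measurable_eP[of n] F by measurable
    also have "?this \<longleftrightarrow> ?thesis"
      by (rule measurable_cong) (simp add: IT.nn_integral_eP F H_def)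
    finally show ?thesis .
  qed
  \<comment> \<open>\<open>C 0 (Suc n)\<close> is by definition the bind of \<open>C 0 n\<close>
    with the kernel of time n.\<close>
  have "(\<integral>\<^sup>+Y. F Y \<partial>IT.C 0 (Suc n) ?u) = (\<integral>\<^sup>+Y. (\<integral>\<^sup>+x. F x \<partial>IT.eP n Y) \<partial>IT.C 0 n ?u)"
    using F IT.measurable_eP[of n] unfolding IT.C.simps
    by (subst nn_integral_bind[where B="PiM {0 ..< Suc n} (\<lambda>_. count_space UNIV)"])
      (auto simp: measurable_cong_sets[OF IT.sets_C[OF sp] refl])
  also have "\<dots> = (\<integral>\<^sup>+Y. H Y \<partial>IT.C 0 n ?u)"
    by (rule nn_integral_cong) (simp add: IT.nn_integral_eP F IT.space_C[OF sp] H_def)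
  finally show ?thesis
    by (simp only: lim[OF F] lim[OF H, symmetric] H_def[symmetric])
qed

lemma sets_random_walk [measurable_cong, simp]:
  "sets (random_walk G y) = sets (PiM UNIV (\<lambda>_. count_space UNIV))"
proof -
  interpret IT: Ionescu_Tulcea "walk_kernel G y" "\<lambda>_. count_space UNIV"
    by (rule Ionescu_Tulcea_walk_kernel)
  show ?thesis by (simp add: random_walk_def)
qed

lemma space_random_walk [simp]: "space (random_walk G y) = UNIV"
  using sets_eq_imp_space_eq[OF sets_random_walk[of G y]] by (simp add: space_PiM)

text \<open>The total mass is read off from the marginal on the empty set of times.\<close>

lemma prob_space_random_walk: "prob_space (random_walk G y)"
proof -
  interpret IT: Ionescu_Tulcea "walk_kernel G y" "\<lambda>_. count_space UNIV"
    by (rule Ionescu_Tulcea_walk_kernel)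
  interpret C: prob_space "IT.CI {}" by (rule IT.PF.prob_space_P) auto
  have "prob_space (distr IT.PF.lim (PiM {} (\<lambda>_. count_space UNIV)) (\<lambda>x. restrict x {}))"
    using C.prob_space_axioms by (simp only: IT.distr_lim finite.emptyI)
  then show ?thesis
    unfolding random_walk_def
    by (rule prob_space_distrD[rotated])
      (auto simp: measurable_cong_sets[OF IT.PF.sets_lim refl] intro!: measurable_restrict_subset
        simp del: restrict_apply)
qed

lemma emeasure_random_walk_UNIV [simp]: "emeasure (random_walk G y) UNIV = 1"
  using prob_space.emeasure_space_1[OF prob_space_random_walk[of G y]] by simp

text \<open>Lists over a countable type are countable, so the preimages of single lists h suffice:
  such a preimage is a finite intersection of coordinate conditions if h has length t, and empty
  otherwise.\<close>

lemma measurable_map_upt: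
  fixes f :: "'a::countable list \<Rightarrow> 'b"
  assumes "{0..<t} \<subseteq> I" and sp: "f \<in> UNIV \<rightarrow> space N"
  shows "(\<lambda>Y. f (map Y [0..<t])) \<in> measurable (PiM I (\<lambda>_. count_space UNIV)) N"
proof -
  have "(\<lambda>Y. map Y [0..<t]) \<in> measurable (PiM I (\<lambda>_. count_space (UNIV :: 'a set))) (count_space UNIV)"
  proof (subst measurable_count_space_eq_countable)
    have "(\<lambda>Y. map Y [0..<t]) -` {h} \<inter> space (PiM I (\<lambda>_. count_space UNIV))
        \<in> sets (PiM I (\<lambda>_. count_space UNIV))" for h :: "'a list"
    proof (cases "length h = t")
      case True
      then have "map Y [0..<t] = h \<longleftrightarrow> (\<forall>i\<in>{0..<t}. Y i = h ! i)" for Y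
        unfolding list_eq_iff_nth_eq by (simp add: Ball_def)
      then have "(\<lambda>Y. map Y [0..<t]) -` {h} \<inter> space (PiM I (\<lambda>_. count_space UNIV)) =
          {Y \<in> space (PiM I (\<lambda>_. count_space UNIV)). \<forall>i\<in>{0..<t}. Y i = h ! i}"
        by blast
      also have "\<dots> \<in> sets (PiM I (\<lambda>_. count_space UNIV))"
      proof (intro sets.sets_Collect_finite_All)
        fix i assume "i \<in> {0..<t}"
        with assms(1) have "(\<lambda>Y. Y i) \<in> measurable (PiM I (\<lambda>_. count_space (UNIV::'a set))) (count_space UNIV)"
          by (intro measurable_component_singleton) auto
        from measurable_sets[OF this, of "{h ! i}"]
        have "(\<lambda>Y. Y i) -` {h ! i} \<inter> space (PiM I (\<lambda>_. count_space UNIV)) \<in> sets (PiM I (\<lambda>_. count_space UNIV))"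
          by simp
        also have "(\<lambda>Y. Y i) -` {h ! i} \<inter> space (PiM I (\<lambda>_. count_space UNIV)) =
          {Y \<in> space (PiM I (\<lambda>_. count_space UNIV)). Y i = h ! i}" by blast
        finally show "{Y \<in> space (PiM I (\<lambda>_. count_space UNIV)). Y i = h ! i} \<in> sets (PiM I (\<lambda>_. count_space UNIV))" .
      qed auto
      finally show ?thesis .
    next
      case False
      then have "map Y [0..<t] \<noteq> h" for Y by (metis length_map length_upt diff_zero)
      then have "(\<lambda>Y. map Y [0..<t]) -` {h} = {}" by blast
      then show ?thesis by (simp only: Int_empty_left sets.empty_sets)
    qed
    then show "(\<lambda>Y. map Y [0..<t]) \<in> space (PiM I (\<lambda>_. count_space UNIV)) \<rightarrow> UNIV \<and>
      (\<forall>h\<in>UNIV. (\<lambda>Y. map Y [0..<t]) -` {h} \<inter> space (PiM I (\<lambda>_. count_space UNIV))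
        \<in> sets (PiM I (\<lambda>_. count_space (UNIV::'a set))))" by blast
  qed simp
  from measurable_compose[OF this, of f N] sp show ?thesis by (simp add: Pi_iff)
qed

lemma borel_measurable_random_walk:
  fixes f :: "'a::countable list \<Rightarrow> ennreal"
  shows "(\<lambda>Y. f (map Y [0..<t])) \<in> borel_measurable (random_walk G y)"
  unfolding measurable_cong_sets[OF sets_random_walk refl] by (rule measurable_map_upt) auto

text \<open>One-step conditioning for functions of the history list, the form in which strategies
  see the past. Time 0 has its own deterministic kernel, hence the two \<open>Suc\<close>.\<close>

lemma nn_integral_random_walk_step:
  fixes f :: "'a::countable list \<Rightarrow> ennreal"
  shows "(\<integral>\<^sup>+Y. f (map Y [0..<Suc (Suc t)]) \<partial>random_walk G y) =
    (\<integral>\<^sup>+Y. (\<integral>\<^sup>+v. f (map Y [0..<Suc t] @ [v]) \<partial>pmf_of_set {v. (Y t, v) \<in> parcs G}) \<partial>random_walk G y)"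
proof -
  have [simp]: "map (restrict Y {0..<n}) [0..<n] = map Y [0..<n]" for Y :: "nat \<Rightarrow> 'a" and n
    by (rule map_cong) auto
  have [simp]: "map (restrict (Y(Suc t := v)) (insert (Suc t) {0..<Suc t})) [0..<Suc (Suc t)] = map Y [0..<Suc t] @ [v]" for Y :: "nat \<Rightarrow> 'a" and v
    by (auto simp: list_eq_iff_nth_eq nth_append less_Suc_eq)
  show ?thesis
    using nn_integral_random_walk_Suc[OF measurable_map_upt[of "Suc (Suc t)" "{0..<Suc (Suc t)}" f borel], of G y]
    by (simp add: walk_kernel_def del: upt_Suc)
qed

lemma AE_random_walk_0:
  fixes y :: "'a::countable"
  shows "AE Y in random_walk G y. Y 0 = y"
proof -
  have "(\<integral>\<^sup>+Y. indicator {h. h \<noteq> [y]} (map Y [0..<1]) \<partial>random_walk G y) = (0::ennreal)"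
    using nn_integral_random_walk_Suc[OF measurable_map_upt[of "Suc 0" "{0..<Suc 0}" "indicator {h. h \<noteq> [y]}" borel], of G y]
    by (simp add: walk_kernel_def)
  then show ?thesis
    by (subst (asm) nn_integral_0_iff_AE) (auto intro!: measurable_map_upt split: split_indicator)
qed

text \<open>The two claims go hand in hand: the next position is a uniform neighbour only if the set
  of neighbours is nonempty, which is known at vertices.\<close>

lemma AE_random_walk_verts_arcs:
  fixes y :: "'a::countable"
  assumes G: "pair_graph G" "\<And>u. u \<in> pverts G \<Longrightarrow> \<exists>v. (u, v) \<in> parcs G" and y: "y \<in> pverts G"
  shows "AE Y in random_walk G y. \<forall>t. Y t \<in> pverts G \<and> (Y t, Y (Suc t)) \<in> parcs G"
proof -
  interpret pair_graph G by fact
  have step: "AE Y in random_walk G y. (Y t, Y (Suc t)) \<in> parcs G"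
    if "AE Y in random_walk G y. Y t \<in> pverts G" for t
  proof -
    define f :: "'a list \<Rightarrow> ennreal" where "f h = indicator {h. (h ! t, h ! Suc t) \<notin> parcs G} h" for h
    have "(\<integral>\<^sup>+Y. f (map Y [0..<Suc (Suc t)]) \<partial>random_walk G y) =
      (\<integral>\<^sup>+Y. (\<integral>\<^sup>+v. f (map Y [0..<Suc t] @ [v]) \<partial>pmf_of_set {v. (Y t, v) \<in> parcs G}) \<partial>random_walk G y)"
      by (rule nn_integral_random_walk_step)
    also have "\<dots> = (\<integral>\<^sup>+Y. 0 \<partial>random_walk G y)"
    proof (rule nn_integral_cong_AE, use that in eventually_elim)
      case (elim Y)
      have "{v. (Y t, v) \<in> parcs G} \<subseteq> snd ` parcs G" by force
      then have fin: "finite {v. (Y t, v) \<in> parcs G}" by (rule finite_subset) auto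
      have "AE v in pmf_of_set {v. (Y t, v) \<in> parcs G}. f (map Y [0..<Suc t] @ [v]) = 0"
        using G(2)[OF elim] fin
        by (auto simp: AE_measure_pmf_iff f_def nth_append set_pmf_of_set simp del: upt_Suc)
      then show ?case by (subst nn_integral_cong_AE[where v="\<lambda>_. 0"]) auto
    qed
    finally have "(\<integral>\<^sup>+Y. f (map Y [0..<Suc (Suc t)]) \<partial>random_walk G y) = 0"
      by (simp del: upt_Suc)
    then have "AE Y in random_walk G y. f (map Y [0..<Suc (Suc t)]) = 0"
      by (subst (asm) nn_integral_0_iff_AE) (auto intro!: borel_measurable_random_walk simp del: upt_Suc)
    then show ?thesis
      by (rule AE_mp) (auto simp: f_def split: split_indicator_asm simp del: upt_Suc intro!: AE_I2)
  qed
  have verts: "AE Y in random_walk G y. Y t \<in> pverts G" for t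
  proof (induction t)
    case 0
    show ?case using AE_random_walk_0 by eventually_elim (simp add: y)
  next
    case (Suc t)
    from step[OF this] show ?case by eventually_elim (auto dest: in_arcsD2)
  qed
  show ?thesis using verts step[OF verts] by (simp add: AE_all_countable AE_conj_iff)
qed

section \<open>Rotated coordinates and the chase\<close>

definition l1 :: "nat \<times> nat \<Rightarrow> nat \<times> nat \<Rightarrow> nat" where
  "l1 u v = nat (\<bar>int (fst u) - int (fst v)\<bar> + \<bar>int (snd u) - int (snd v)\<bar>)"

lemma l1_commute: "l1 u v = l1 v u"
  by (auto simp: l1_def)

lemma int_l1: "int (l1 u v) = \<bar>int (fst u) - int (fst v)\<bar> + \<bar>int (snd u) - int (snd v)\<bar>"
  by (simp add: l1_def)

lemma l1_triangle: "l1 u w \<le> l1 u v + l1 v w"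
proof -
  have "\<bar>a - c\<bar> \<le> \<bar>a - b\<bar> + \<bar>b - c\<bar>" for a b c :: int by linarith
  from add_mono[OF this this] have "int (l1 u w) \<le> int (l1 u v + l1 v w)"
    unfolding int_l1 of_nat_add by (simp add: algebra_simps)
  then show ?thesis by simp
qed

lemma l1_eq_0_iff [simp]: "l1 u v = 0 \<longleftrightarrow> u = v"
  by (auto simp: l1_def prod_eq_iff)

lemma l1_self [simp]: "l1 u u = 0"
  by simp

lemma pverts_grid_iff: "u \<in> pverts (grid n) \<longleftrightarrow> fst u < n \<and> snd u < n"
  by (auto simp: grid_def cartesian_product_def path_graph_def mem_Times_iff)

lemma parcs_grid_iff:
  "(u, v) \<in> parcs (grid n) \<longleftrightarrow> u \<in> pverts (grid n) \<and> v \<in> pverts (grid n) \<and> l1 u v = 1"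
  by (cases u; cases v)
    (auto simp: grid_def cartesian_product_def path_graph_def l1_def abs_if split: if_splits)

lemma stay_or_move_gridD:
  assumes "stay_or_move (grid n) u v"
  shows "l1 u v \<le> 1" and "u \<in> pverts (grid n) \<Longrightarrow> v \<in> pverts (grid n)"
  using assms by (auto simp: stay_or_move_def parcs_grid_iff)

definition toward :: "nat \<Rightarrow> nat \<Rightarrow> nat" where
  "toward a x = (if a < x then Suc a else a - 1)"

lemma int_toward: "a \<noteq> x \<Longrightarrow> int (toward a x) = int a + sgn (int x - int a)"
  by (auto simp: toward_def)

text \<open>The fallback to c keeps the step legal for all arguments, since a strategy must be legal
  at every history. For distinct vertices c and r of the grid it is never taken.\<close>

definition cop_step :: "nat \<Rightarrow> nat \<times> nat \<Rightarrow> nat \<times> nat \<Rightarrow> nat \<times> nat" where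
  "cop_step n c r = (let c' = (if \<bar>int (fst c) - int (fst r)\<bar> \<ge> \<bar>int (snd c) - int (snd r)\<bar>
       then (toward (fst c) (fst r), snd c) else (fst c, toward (snd c) (snd r)))
     in if (c, c') \<in> parcs (grid n) then c' else c)"

lemma stay_or_move_cop_step: "stay_or_move (grid n) c (cop_step n c r)"
  by (simp add: cop_step_def stay_or_move_def Let_def)

lemma cop_step_in_grid: "c \<in> pverts (grid n) \<Longrightarrow> cop_step n c r \<in> pverts (grid n)"
  using stay_or_move_gridD(2)[OF stay_or_move_cop_step] .

lemma cop_step_cases:
  assumes "c \<in> pverts (grid n)" "r \<in> pverts (grid n)" "c \<noteq> r"
  obtains (x) "\<bar>int (fst c) - int (fst r)\<bar> \<ge> \<bar>int (snd c) - int (snd r)\<bar>" "fst c \<noteq> fst r"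
      "cop_step n c r = (toward (fst c) (fst r), snd c)"
    | (y) "\<bar>int (fst c) - int (fst r)\<bar> < \<bar>int (snd c) - int (snd r)\<bar>"
      "cop_step n c r = (fst c, toward (snd c) (snd r))"
proof (cases "\<bar>int (fst c) - int (fst r)\<bar> \<ge> \<bar>int (snd c) - int (snd r)\<bar>")
  case True
  then have ne: "fst c \<noteq> fst r" using assms(3) by (auto simp: prod_eq_iff)
  then have "(c, (toward (fst c) (fst r), snd c)) \<in> parcs (grid n)"
    using assms by (auto simp: parcs_grid_iff pverts_grid_iff toward_def l1_def)
  then show ?thesis using True ne by (intro x) (auto simp: cop_step_def)
next
  case False
  then have "(c, (fst c, toward (snd c) (snd r))) \<in> parcs (grid n)"
    using assms by (auto simp: parcs_grid_iff pverts_grid_iff toward_def l1_def)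
  then show ?thesis using False by (intro y) (auto simp: cop_step_def)
qed

lemma l1_cop_step:
  assumes "c \<in> pverts (grid n)" "r \<in> pverts (grid n)" "c \<noteq> r"
  shows "Suc (l1 (cop_step n c r) r) = l1 c r"
  using assms by (cases rule: cop_step_cases) (auto simp: l1_def toward_def)

text \<open>
  A move of a cop or of the robber changes each of the two rotated coordinates x + y and x - y
  by 1, and the two changes can be prescribed independently of each other.
\<close>

definition rot :: "int \<times> int \<Rightarrow> nat \<times> nat \<Rightarrow> int" where
  "rot s u = fst s * int (fst u) + snd s * int (snd u)"

text \<open>The larger coordinate difference decides the sign of both rotated differences, so a step
  along it moves forward in every rotated direction in which the cop is behind.\<close>

lemma rot_cop_step:
  assumes "c \<in> pverts (grid n)" "r \<in> pverts (grid n)" "c \<noteq> r" "s \<in> {-1, 1} \<times> {-1, 1}"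
  shows "rot s c < rot s r \<Longrightarrow> rot s (cop_step n c r) = rot s c + 1"
    and "\<bar>rot s (cop_step n c r) - rot s c\<bar> = 1"
proof -
  obtain p q where s: "s = (p, q)" and p: "p = 1 \<or> p = -1" and q: "q = 1 \<or> q = -1"
    using assms(4) by auto
  have aux: "p * x + q * y < p * x' + q * y' \<longrightarrow> p * (x + sgn (x' - x)) = p * x + 1"
    if "\<bar>x - x'\<bar> \<ge> \<bar>y - y'\<bar>" "p = 1 \<or> p = -1" "q = 1 \<or> q = -1"
    for p q x x' y y' :: int
    using that by (auto simp: sgn_if)
  have aux2: "\<bar>p * (x + sgn (x' - x)) - p * x\<bar> = 1" if "p = 1 \<or> p = -1" "x \<noteq> x'" for p x x' :: int
    using that by (auto simp: sgn_if)
  have *: "(rot s c < rot s r \<longrightarrow> rot s (cop_step n c r) = rot s c + 1) \<and>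
      \<bar>rot s (cop_step n c r) - rot s c\<bar> = 1"
    using assms(1-3)
  proof (cases rule: cop_step_cases)
    case x
    show ?thesis
      using aux[OF x(1) p q] aux2[OF p, of "int (fst c)" "int (fst r)"] x(2)
      by (simp add: rot_def s x(3) int_toward)
  next
    case y
    then have ne: "snd c \<noteq> snd r" by auto
    from y have "\<bar>int (snd c) - int (snd r)\<bar> \<ge> \<bar>int (fst c) - int (fst r)\<bar>" by simp
    from aux[OF this q p] aux2[OF q, of "int (snd c)" "int (snd r)"] ne show ?thesis
      by (simp add: rot_def s y(2) int_toward algebra_simps)
  qed
  show "rot s c < rot s r \<Longrightarrow> rot s (cop_step n c r) = rot s c + 1"
    and "\<bar>rot s (cop_step n c r) - rot s c\<bar> = 1"
    using * by auto
qed

lemma rot_stay_or_move: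
  assumes "stay_or_move (grid n) u v" "s \<in> {-1, 1} \<times> {-1, 1}"
  shows "\<bar>rot s v - rot s u\<bar> \<le> 1"
  using stay_or_move_gridD(1)[OF assms(1)] assms(2) by (auto simp: rot_def l1_def)

text \<open>The l1 distance is the maximum of \<open>rot s u - rot s v\<close> over the four sign
  pairs s.\<close>

lemma l1_le_1_if_rot:
  assumes "\<And>s. s \<in> {-1, 1} \<times> {-1, 1} \<Longrightarrow> rot s u - rot s v \<le> 1"
  shows "l1 u v \<le> 1"
  using assms[of "(1, 1)"] assms[of "(1, -1)"] assms[of "(-1, 1)"] assms[of "(-1, -1)"]
  by (auto simp: rot_def l1_def)

definition chase :: "nat \<Rightarrow> nat \<times> nat \<Rightarrow> (nat \<times> nat) list \<Rightarrow> nat \<times> nat" where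
  "chase n c h = foldl (cop_step n) c h"

lemma chase_simps [simp]: "chase n c [] = c" "chase n c (h @ [r]) = cop_step n (chase n c h) r"
  by (simp_all add: chase_def)

lemma chase_in_grid: "c \<in> pverts (grid n) \<Longrightarrow> chase n c h \<in> pverts (grid n)"
  by (induction h rule: rev_induct) (simp_all add: cop_step_in_grid)

lemma chase_cop_strategy: "(\<lambda>h. map (\<lambda>c. chase n c h) x) \<in> cop_strategies (grid n) x"
  by (simp add: cop_strategies_def list_all2_conv_all_nth stay_or_move_cop_step)

section \<open>Legal trajectories and bounds for the capture time\<close>

lemma capture_time_le:
  assumes "Y t \<in> set (X t) \<or> (t > 0 \<and> Y (t - 1) \<in> set (X t))"
  shows "capture_time X Y \<le> enat t"
  unfolding capture_time_def using assms by (intro INF_lower) simp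

lemma capture_time_ge:
  assumes "\<And>t. enat t < m \<Longrightarrow> Y t \<notin> set (X t)" "\<And>t. enat (Suc t) < m \<Longrightarrow> Y t \<notin> set (X (Suc t))"
  shows "m \<le> capture_time X Y"
  unfolding capture_time_def
proof (rule INF_greatest)
  fix t assume "t \<in> {t. Y t \<in> set (X t) \<or> (t > 0 \<and> Y (t - 1) \<in> set (X t))}"
  then show "m \<le> enat t" using assms(1)[of t] assms(2)[of "t - 1"] by (auto simp: not_less[symmetric])
qed

lemma robber_trajectory_eq:
  "robber_trajectory \<sigma> \<rho> t = \<rho> (map (cop_trajectory \<sigma> (robber_trajectory \<sigma> \<rho>)) [0..<Suc t])"
  by (subst robber_trajectory.simps) (simp add: cop_trajectory_def[abs_def])

lemma robber_trajectory_legal: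
  assumes "\<rho> \<in> robber_strategies G"
  shows "robber_trajectory \<sigma> \<rho> 0 \<in> pverts G"
    and "stay_or_move G (robber_trajectory \<sigma> \<rho> t) (robber_trajectory \<sigma> \<rho> (Suc t))"
proof -
  show "robber_trajectory \<sigma> \<rho> 0 \<in> pverts G"
    using assms by (simp add: robber_strategies_def robber_trajectory_eq[of _ _ 0])
  let ?h = "map (cop_trajectory \<sigma> (robber_trajectory \<sigma> \<rho>)) [0..<Suc t]"
  have "stay_or_move G (\<rho> ?h) (\<rho> (?h @ [cop_trajectory \<sigma> (robber_trajectory \<sigma> \<rho>) (Suc t)]))"
  proof -
    have "h \<noteq> [] \<Longrightarrow> stay_or_move G (\<rho> h) (\<rho> (h @ [x]))" for h x
      using assms by (simp add: robber_strategies_def)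
    from this[of ?h] show ?thesis by simp
  qed
  then show "stay_or_move G (robber_trajectory \<sigma> \<rho> t) (robber_trajectory \<sigma> \<rho> (Suc t))"
    by (simp add: robber_trajectory_eq[of _ _ t] robber_trajectory_eq[of _ _ "Suc t"])
qed

lemma cop_trajectory_legal:
  assumes "\<sigma> \<in> cop_strategies G x"
  shows "cop_trajectory \<sigma> Y 0 = x" "length (cop_trajectory \<sigma> Y t) = length x"
    "i < length x \<Longrightarrow> stay_or_move G (cop_trajectory \<sigma> Y t ! i) (cop_trajectory \<sigma> Y (Suc t) ! i)"
proof -
  have step: "list_all2 (stay_or_move G) (cop_trajectory \<sigma> Y t) (cop_trajectory \<sigma> Y (Suc t))" for t
    using assms by (simp add: cop_strategies_def cop_trajectory_def)
  show 0: "cop_trajectory \<sigma> Y 0 = x" using assms by (simp add: cop_strategies_def cop_trajectory_def)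
  show len: "length (cop_trajectory \<sigma> Y t) = length x" for t
    using 0 list_all2_lengthD[OF step] by (induction t) simp_all
  show "i < length x \<Longrightarrow> stay_or_move G (cop_trajectory \<sigma> Y t ! i) (cop_trajectory \<sigma> Y (Suc t) ! i)"
    using step[of t] len by (simp add: list_all2_conv_all_nth)
qed

lemma l1_cop_trajectory:
  assumes "\<sigma> \<in> cop_strategies (grid n) x" "i < length x"
  shows "l1 (x ! i) (cop_trajectory \<sigma> Y t ! i) \<le> t"
proof (induction t)
  case (Suc t)
  show ?case
    using l1_triangle[of "x ! i" "cop_trajectory \<sigma> Y (Suc t) ! i" "cop_trajectory \<sigma> Y t ! i"] Suc
      stay_or_move_gridD(1)[OF cop_trajectory_legal(3)[OF assms, of Y t]]
    by (simp add: l1_commute)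
qed (simp add: cop_trajectory_legal(1)[OF assms(1)])

section \<open>Two chasing cops against the sober robber\<close>

lemma rot_bounds:
  assumes "u \<in> pverts (grid n)"
  shows "rot (1, 1) u \<le> 2 * int n - 2" "rot (1, -1) u \<le> int n - 1" "rot (-1, 1) u \<le> int n - 1"
    "rot (-1, -1) u \<le> 0"
  using assms by (auto simp: rot_def pverts_grid_iff)

text \<open>
  As long as the robber is at least 2 ahead in some rotated direction, the cop gains 1 in this
  direction in every round, which can happen for about n rounds only.
\<close>

lemma l1_chase_le_1:
  assumes c: "c \<in> pverts (grid n)" "\<bar>int (fst c) - int (n div 2)\<bar> \<le> 1" "snd c = n div 2"
    and Y: "\<And>t. Y t \<in> pverts (grid n)" "\<And>t. stay_or_move (grid n) (Y t) (Y (Suc t))"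
    and not_captured: "\<And>t. t < n + 5 \<Longrightarrow> chase n c (map Y [0..<t]) \<noteq> Y t"
  shows "l1 (Y (n + 4)) (chase n c (map Y [0..<n + 5])) \<le> 1"
proof (rule l1_le_1_if_rot)
  fix s :: "int \<times> int" assume s: "s \<in> {-1, 1} \<times> {-1, 1}"
  define C where "C t = chase n c (map Y [0..<t])" for t
  have C_Suc: "C (Suc t) = cop_step n (C t) (Y t)" for t by (simp add: C_def)
  have C: "C t \<in> pverts (grid n)" for t by (simp add: C_def chase_in_grid c)
  have gain: "rot s (C (Suc t)) = rot s (C t) + 1" if "t < n + 5" "rot s (C t) < rot s (Y t)" for t
    unfolding C_Suc using rot_cop_step(1)[OF C Y(1) _ s] not_captured that by (simp add: C_def)
  have speed: "\<bar>rot s (C (Suc t)) - rot s (C t)\<bar> = 1" if "t < n + 5" for t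
    unfolding C_Suc using rot_cop_step(2)[OF C Y(1) _ s] not_captured that by (simp add: C_def)
  \<comment> \<open>A lead of at most 1 persists: the robber adds at most 1, and the cop regains 1
    if he is behind and loses at most 1 otherwise. As long as there has been no such lead, the cop
    has gained 1 in every round.\<close>
  have inv: "rot s (Y t) - rot s (C (Suc t)) \<le> 1 \<or> rot s (C (Suc t)) = rot s c + int (Suc t)"
    if "t < n + 5" for t
    using that
  proof (induction t)
    case 0
    then show ?case using gain[of 0] speed[of 0] by (cases "rot s (C 0) < rot s (Y 0)") (auto simp: C_def)
  next
    case (Suc t)
    have "\<bar>rot s (Y (Suc t)) - rot s (Y t)\<bar> \<le> 1" by (rule rot_stay_or_move[OF Y(2) s])
    then show ?case using Suc gain[of "Suc t"] speed[of "Suc t"]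
      by (cases "rot s (C (Suc t)) < rot s (Y (Suc t))") auto
  qed
  \<comment> \<open>Seen from the centre, no vertex is farther ahead than about n in a rotated
    direction, so n + 5 uninterrupted gains would carry the cop past the robber.\<close>
  have bound: "rot s (Y (n + 4)) \<le> rot s c + int n + 4"
    using s rot_bounds[OF Y(1)[of "n + 4"]] c(2,3) by (auto simp: rot_def)
  show "rot s (Y (n + 4)) - rot s (chase n c (map Y [0..<n + 5])) \<le> 1"
  proof -
    have "Suc (n + 4) = n + 5" by simp
    from inv[of "n + 4", unfolded this C_def] bound show ?thesis by auto
  qed
qed

definition center_cops :: "nat \<Rightarrow> (nat \<times> nat) list" where
  "center_cops n = [(n div 2, n div 2), (n div 2 - 1, n div 2)]"

lemma odd_if_abs_eq_1: "\<bar>d\<bar> = 1 \<Longrightarrow> odd (d :: int)"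
  by (auto simp: abs_if split: if_splits)

text \<open>Before the capture every round of the chase is a move along an edge, even if the robber
  stays, so the parity of the coordinate sum alternates.\<close>

lemma chase_parity:
  assumes c: "c \<in> pverts (grid n)" and Y: "\<And>t. Y t \<in> pverts (grid n)"
    and not_captured: "\<And>s. s < t \<Longrightarrow> chase n c (map Y [0..<s]) \<noteq> Y s"
  shows "even (rot (1, 1) (chase n c (map Y [0..<t])) - rot (1, 1) c - int t)"
  using not_captured
proof (induction t)
  case (Suc t)
  then have "chase n c (map Y [0..<t]) \<noteq> Y t" by simp
  from rot_cop_step(2)[OF chase_in_grid[OF c] Y this, of "(1, 1)"]
  have "odd (rot (1, 1) (chase n c (map Y [0..<Suc t])) - rot (1, 1) (chase n c (map Y [0..<t])))"
    by (intro odd_if_abs_eq_1) simp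
  moreover have "even (rot (1, 1) (chase n c (map Y [0..<t])) - rot (1, 1) c - int t)"
    using Suc by simp
  ultimately show ?case by (simp del: upt_Suc) blast
qed simp

lemma center_cops_capture:
  assumes n: "n \<ge> 2" and \<rho>: "\<rho> \<in> robber_strategies (grid n)"
  shows "game_capture_time (\<lambda>h. map (\<lambda>c. chase n c h) (center_cops n)) \<rho> \<le> enat (n + 5)"
proof (rule ccontr)
  define \<sigma> where "\<sigma> = (\<lambda>h. map (\<lambda>c. chase n c h) (center_cops n))"
  define Y where "Y = robber_trajectory \<sigma> \<rho>"
  define C where "C c t = chase n c (map Y [0..<t])" for c t
  have traj: "cop_trajectory \<sigma> Y t = map (\<lambda>c. C c t) (center_cops n)" for t
    by (simp add: cop_trajectory_def \<sigma>_def C_def)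
  assume "\<not> game_capture_time (\<lambda>h. map (\<lambda>c. chase n c h) (center_cops n)) \<rho> \<le> enat (n + 5)"
  then have no: "capture_time (cop_trajectory \<sigma> Y) Y > enat (n + 5)"
    by (simp add: game_capture_time_def \<sigma>_def[symmetric] Y_def[symmetric])
  have nc1: "C c t \<noteq> Y t" if "t \<le> n + 5" "c \<in> set (center_cops n)" for c t
  proof
    assume "C c t = Y t"
    then have "Y t \<in> set (cop_trajectory \<sigma> Y t)"
      using imageI[OF that(2), of "\<lambda>c. C c t"] by (simp add: traj)
    then have "capture_time (cop_trajectory \<sigma> Y) Y \<le> enat t" by (intro capture_time_le) simp
    also have "enat t \<le> enat (n + 5)" using that by simp
    finally show False using no by simp
  qed
  have nc2: "C c (n + 5) \<noteq> Y (n + 4)" if "c \<in> set (center_cops n)" for c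
  proof
    assume "C c (n + 5) = Y (n + 4)"
    moreover have "n + 5 - 1 = n + 4" by simp
    ultimately have "Y (n + 5 - 1) \<in> set (cop_trajectory \<sigma> Y (n + 5))"
      using imageI[OF that, of "\<lambda>c. C c (n + 5)"] by (simp only: traj set_map)
    then have "capture_time (cop_trajectory \<sigma> Y) Y \<le> enat (n + 5)" by (intro capture_time_le) simp
    with no show False by simp
  qed
  have Ys: "stay_or_move (grid n) (Y t) (Y (Suc t))" for t
    unfolding Y_def by (rule robber_trajectory_legal[OF \<rho>])
  have Yv: "Y t \<in> pverts (grid n)" for t
    by (induction t) (use robber_trajectory_legal(1)[OF \<rho>] stay_or_move_gridD(2)[OF Ys] in \<open>auto simp: Y_def\<close>)
  have cv: "c \<in> pverts (grid n)" if "c \<in> set (center_cops n)" for c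
    using that n by (auto simp: center_cops_def pverts_grid_iff)
  \<comment> \<open>Both cops are next to the same vertex, so their coordinate sums have the same
    parity; but they made equally many moves from starts of opposite parity.\<close>
  have "l1 (Y (n + 4)) (C c (n + 5)) = 1 \<and> even (rot (1, 1) (C c (n + 5)) - rot (1, 1) c - int (n + 5))"
    if c: "c \<in> set (center_cops n)" for c
  proof
    have "l1 (Y (n + 4)) (C c (n + 5)) \<le> 1"
      unfolding C_def using c nc1[OF _ c] n
      by (intro l1_chase_le_1 cv Yv Ys) (auto simp: center_cops_def C_def)
    moreover have "l1 (Y (n + 4)) (C c (n + 5)) \<noteq> 0" using nc2[OF c] by simp
    ultimately show "l1 (Y (n + 4)) (C c (n + 5)) = 1" by linarith
    show "even (rot (1, 1) (C c (n + 5)) - rot (1, 1) c - int (n + 5))"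
      unfolding C_def using nc1[OF _ c] by (intro chase_parity cv c Yv) (auto simp: C_def)
  qed
  from this[of "(n div 2, n div 2)"] this[of "(n div 2 - 1, n div 2)"]
  have l: "l1 (Y (n + 4)) (C (n div 2, n div 2) (n + 5)) = 1" "l1 (Y (n + 4)) (C (n div 2 - 1, n div 2) (n + 5)) = 1"
    and e: "even (rot (1, 1) (C (n div 2, n div 2) (n + 5)) - rot (1, 1) (n div 2, n div 2) - int (n + 5))"
     "even (rot (1, 1) (C (n div 2 - 1, n div 2) (n + 5)) - rot (1, 1) (n div 2 - 1, n div 2) - int (n + 5))"
    by (auto simp: center_cops_def)
  have odd_l1: "odd (rot (1, 1) u - rot (1, 1) v)" if "l1 u v = 1" for u v
  proof (rule odd_if_abs_eq_1)
    have "\<bar>int (fst u) - int (fst v)\<bar> + \<bar>int (snd u) - int (snd v)\<bar> = 1"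
      using that int_l1[of u v] by simp
    then show "\<bar>rot (1, 1) u - rot (1, 1) v\<bar> = 1" unfolding rot_def fst_conv snd_conv mult_1 by linarith
  qed
  have "rot (1, 1) (n div 2, n div 2) = rot (1, 1) (n div 2 - 1, n div 2) + 1"
    using n by (auto simp: rot_def of_nat_diff)
  moreover have False if "odd (y - c1)" "odd (y - c2)" "even (c1 - a1 - m)" "even (c2 - a2 - m)" "a1 = a2 + 1"
    for y c1 c2 a1 a2 m :: int
    using that by presburger
  ultimately show False using e odd_l1[OF l(1)] odd_l1[OF l(2)] by blast
qed

section \<open>The capture time\<close>

lemma center_cops_in_positions: "n \<ge> 2 \<Longrightarrow> center_cops n \<in> cop_positions (grid n) 2"
  by (auto simp: center_cops_def cop_positions_def pverts_grid_iff)

lemma ct_k_grid_2_le: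
  assumes "n \<ge> 2"
  shows "ct_k (grid n) 2 \<le> enat (n + 5)"
  unfolding ct_k_def ct_from_def
  by (rule INF_lower2[OF center_cops_in_positions[OF assms]], rule SUP_least,
      rule INF_lower2[OF chase_cop_strategy], rule SUP_least)
    (use center_cops_capture[OF assms] in auto)

text \<open>
  The robber on a 4-cycle \<open>{A, A + 1} \<times> {B, B + 1}\<close> evades a single cop by staying opposite to the
  image of the cop under the retraction of the grid onto this cycle.
\<close>

definition opposite :: "nat \<Rightarrow> nat \<Rightarrow> nat" where
  "opposite A a = (if a \<le> A then Suc A else A)"

definition opposite2 :: "nat \<times> nat \<Rightarrow> nat \<times> nat \<Rightarrow> nat \<times> nat" where
  "opposite2 A c = (opposite (fst A) (fst c), opposite (snd A) (snd c))"

text \<open>The test makes the strategy legal at every history. Against a legally moving cop i it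
  always succeeds, by \<open>opposite_step\<close>.\<close>

definition evade :: "nat \<Rightarrow> nat \<times> nat \<Rightarrow> nat \<Rightarrow> (nat \<times> nat) list list \<Rightarrow> nat \<times> nat" where
  "evade n A i h = foldl (\<lambda>r x. if stay_or_move (grid n) r (opposite2 A (x ! i)) then opposite2 A (x ! i) else r)
     (opposite2 A (hd h ! i)) (tl h)"

lemma evade_simps:
  "evade n A i [x] = opposite2 A (x ! i)"
  "h \<noteq> [] \<Longrightarrow> evade n A i (h @ [x]) =
    (if stay_or_move (grid n) (evade n A i h) (opposite2 A (x ! i)) then opposite2 A (x ! i) else evade n A i h)"
  by (simp_all add: evade_def)

lemma opposite2_in_grid:
  assumes "Suc (fst A) < n" "Suc (snd A) < n"
  shows "opposite2 A c \<in> pverts (grid n)"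
  using assms by (auto simp: opposite2_def opposite_def pverts_grid_iff)

lemma evade_strategy:
  assumes "Suc (fst A) < n" "Suc (snd A) < n"
  shows "evade n A i \<in> robber_strategies (grid n)"
  using opposite2_in_grid[OF assms]
  by (auto simp: robber_strategies_def evade_simps) (simp add: stay_or_move_def)

text \<open>The retraction does not increase distances, so the robber can follow the image of the
  cop. His vertex differs from that of the cop in both coordinates, whereas a move of the cop
  changes only one.\<close>

lemma opposite_step:
  assumes A: "Suc (fst A) < n" "Suc (snd A) < n" and "stay_or_move (grid n) c c'"
  shows "stay_or_move (grid n) (opposite2 A c) (opposite2 A c')" "opposite2 A c \<noteq> c'" "opposite2 A c \<noteq> c"
proof -
  have l: "\<bar>int (fst c) - int (fst c')\<bar> + \<bar>int (snd c) - int (snd c')\<bar> \<le> 1"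
    using stay_or_move_gridD(1)[OF assms(3)] int_l1[of c c'] by simp
  then have fs: "fst c = fst c' \<and> \<bar>int (snd c) - int (snd c')\<bar> \<le> 1 \<or>
      snd c = snd c' \<and> \<bar>int (fst c) - int (fst c')\<bar> \<le> 1"
    by linarith
  have ne: "opposite b a \<noteq> a" for b a by (simp add: opposite_def)
  show "opposite2 A c \<noteq> c" by (auto simp: opposite2_def prod_eq_iff ne)
  from fs ne show "opposite2 A c \<noteq> c'" by (auto simp: opposite2_def prod_eq_iff)
  have "l1 (opposite2 A c) (opposite2 A c') \<le> 1"
    using fs by (auto simp: l1_def opposite2_def opposite_def)
  then consider "l1 (opposite2 A c) (opposite2 A c') = 0" | "l1 (opposite2 A c) (opposite2 A c') = 1"
    by linarith
  then show "stay_or_move (grid n) (opposite2 A c) (opposite2 A c')"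
    using opposite2_in_grid[OF A, of c] opposite2_in_grid[OF A, of c']
    by cases (auto simp: stay_or_move_def parcs_grid_iff)
qed

text \<open>Only the other cops can catch this robber, and they need m rounds to reach his cycle. As
  m is an \<open>enat\<close>, the case of a single cop is included: \<open>far\<close> is then
  vacuous and m may be \<open>\<infinity>\<close>.\<close>

lemma evade_capture_time:
  assumes A: "Suc (fst A) < n" "Suc (snd A) < n"
    and \<sigma>: "\<sigma> \<in> cop_strategies (grid n) x" and i: "i < length x"
    and far: "\<And>j c. j < length x \<Longrightarrow> j \<noteq> i \<Longrightarrow> m \<le> enat (l1 (x ! j) (opposite2 A c))"
  shows "m \<le> game_capture_time \<sigma> (evade n A i)"
proof -
  define Y where "Y = robber_trajectory \<sigma> (evade n A i)"
  define X where "X = cop_trajectory \<sigma> Y"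
  have X: "stay_or_move (grid n) (X t ! i) (X (Suc t) ! i)" "length (X t) = length x" for t
    unfolding X_def using cop_trajectory_legal[OF \<sigma>] i by auto
  have "Y t = evade n A i (map X [0..<Suc t])" for t
    unfolding Y_def X_def by (rule robber_trajectory_eq)
  moreover have "evade n A i (map X [0..<Suc t]) = opposite2 A (X t ! i)" for t
  proof (induction t)
    case (Suc t)
    have "map X [0..<Suc (Suc t)] = map X [0..<Suc t] @ [X (Suc t)]" by simp
    then show ?case using opposite_step(1)[OF A X(1), of t] Suc
      by (simp add: evade_simps(2) del: upt_Suc)
  qed (simp add: evade_simps)
  ultimately have Y: "Y t = opposite2 A (X t ! i)" for t by simp
  have other: "enat t \<ge> m" if "X t ! j = opposite2 A c" "j < length x" "j \<noteq> i" for t j c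
  proof -
    have "m \<le> enat (l1 (x ! j) (X t ! j))" using far[OF that(2,3)] that(1) by simp
    also have "\<dots> \<le> enat t" using l1_cop_trajectory[OF \<sigma> that(2)] by (simp add: X_def)
    finally show ?thesis .
  qed
  show ?thesis
    unfolding game_capture_time_def Let_def Y_def[symmetric] X_def[symmetric]
  proof (rule capture_time_ge)
    fix t assume t: "enat t < m"
    show "Y t \<notin> set (X t)"
    proof
      assume "Y t \<in> set (X t)"
      then obtain j where j: "j < length x" "X t ! j = opposite2 A (X t ! i)"
        by (auto simp: in_set_conv_nth X(2) Y)
      with opposite_step(3)[OF A X(1), of t] have "j \<noteq> i" by auto
      from other[OF j(2,1) this] t show False by simp
    qed
  next
    fix t assume t: "enat (Suc t) < m"
    show "Y t \<notin> set (X (Suc t))"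
    proof
      assume "Y t \<in> set (X (Suc t))"
      then obtain j where j: "j < length x" "X (Suc t) ! j = opposite2 A (X t ! i)"
        by (auto simp: in_set_conv_nth X(2) Y)
      with opposite_step(2)[OF A X(1), of t] have "j \<noteq> i" by auto
      from other[OF j(2,1) this] t show False by simp
    qed
  qed
qed

lemma cop_number_grid:
  assumes n: "n \<ge> 2"
  shows "cop_number (grid n) = 2"
  unfolding cop_number_def
proof (rule Least_equality)
  have "\<forall>\<rho>\<in>robber_strategies (grid n). game_capture_time (\<lambda>h. map (\<lambda>c. chase n c h) (center_cops n)) \<rho> < \<infinity>"
    by (intro ballI le_less_trans[OF center_cops_capture[OF n]]) auto
  with center_cops_in_positions[OF n] chase_cop_strategy
  show "\<exists>x\<in>cop_positions (grid n) 2. \<exists>\<sigma>\<in>cop_strategies (grid n) x.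
      \<forall>\<rho>\<in>robber_strategies (grid n). game_capture_time \<sigma> \<rho> < \<infinity>" by blast
next
  fix k assume "\<exists>x\<in>cop_positions (grid n) k. \<exists>\<sigma>\<in>cop_strategies (grid n) x.
      \<forall>\<rho>\<in>robber_strategies (grid n). game_capture_time \<sigma> \<rho> < \<infinity>"
  then obtain x \<sigma> where x: "x \<in> cop_positions (grid n) k" and \<sigma>: "\<sigma> \<in> cop_strategies (grid n) x"
    and fin: "\<And>\<rho>. \<rho> \<in> robber_strategies (grid n) \<Longrightarrow> game_capture_time \<sigma> \<rho> < \<infinity>" by blast
  let ?\<rho> = "evade n (0, 0) 0"
  have \<rho>: "?\<rho> \<in> robber_strategies (grid n)" using n by (intro evade_strategy) auto
  have "\<infinity> \<le> game_capture_time \<sigma> ?\<rho>" if "k < 2"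
  proof (cases k)
    case 0
    then have "set (cop_trajectory \<sigma> Y t) = {}" for Y t
      using cop_trajectory_legal(2)[OF \<sigma>] x by (simp add: cop_positions_def)
    then show ?thesis unfolding game_capture_time_def Let_def by (intro capture_time_ge) auto
  next
    case Suc
    then show ?thesis using n x that
      by (intro evade_capture_time[OF _ _ \<sigma>]) (auto simp: cop_positions_def)
  qed
  with fin[OF \<rho>] show "2 \<le> k" by (cases "k < 2") auto
qed

lemma ct_k_grid_2_ge:
  assumes n: "n \<ge> 2"
  shows "enat (n - 3) \<le> ct_k (grid n) 2"
  unfolding ct_k_def
proof (rule INF_greatest)
  fix x assume x: "x \<in> cop_positions (grid n) 2"
  then have len: "length x = 2" and grid: "x ! 1 \<in> pverts (grid n)"
    by (auto simp: cop_positions_def)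
  \<comment> \<open>In each coordinate the robber takes the two lines at the end of the grid farther
    from the second cop. Both are at least (n - 3) / 2 away, which makes n - 3 for two
    coordinates.\<close>
  define far where "far a = (if 2 * a < n then n - 2 else 0)" for a
  define A where "A = (far (fst (x ! 1)), far (snd (x ! 1)))"
  have A: "Suc (fst A) < n" "Suc (snd A) < n" using n by (auto simp: A_def far_def)
  have l1: "n - 3 \<le> l1 (x ! 1) (opposite2 A c)" for c
  proof -
    have "real n / 2 - 3/2 \<le> \<bar>real a - real (opposite (far a) b)\<bar>" if "a < n" for a b
      using that n by (auto simp: far_def opposite_def of_nat_diff)
    from this[of "fst (x ! 1)" "fst c"] this[of "snd (x ! 1)" "snd c"] grid
    have "real n - 3 \<le> real (l1 (x ! 1) (opposite2 A c))"
      unfolding l1_def by (simp add: pverts_grid_iff opposite2_def A_def)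
    then show ?thesis by linarith
  qed
  have "enat (n - 3) \<le> ct_from (grid n) x (opposite2 A (x ! 0))"
    unfolding ct_from_def
  proof (rule INF_greatest, rule SUP_upper2)
    fix \<sigma> assume \<sigma>: "\<sigma> \<in> cop_strategies (grid n) x"
    show "evade n A 0 \<in> {\<rho> \<in> robber_strategies (grid n). \<rho> [x] = opposite2 A (x ! 0)}"
      using evade_strategy[OF A] by (simp add: evade_simps)
    show "enat (n - 3) \<le> game_capture_time \<sigma> (evade n A 0)"
    proof (rule evade_capture_time[OF A \<sigma>])
      fix j c assume "j < length x" "j \<noteq> 0"
      then have "j = 1" using len by auto
      then show "enat (n - 3) \<le> enat (l1 (x ! j) (opposite2 A c))" using l1 by simp
    qed (simp add: len)
  qed
  then show "enat (n - 3) \<le> (SUP y\<in>pverts (grid n). ct_from (grid n) x y)"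
    by (rule SUP_upper2[OF opposite2_in_grid[OF A]])
qed

lemma ct_grid_bounds:
  assumes "n \<ge> 2"
  shows "enat (n - 3) \<le> ct (grid n)" "ct (grid n) \<le> enat (n + 5)"
  using ct_k_grid_2_ge[OF assms] ct_k_grid_2_le[OF assms] by (simp_all add: ct_def cop_number_grid assms)

section \<open>Two centres in the grid\<close>

definition dist_sum :: "nat \<Rightarrow> real \<Rightarrow> real" where
  "dist_sum n a = (\<Sum>x<n. \<bar>real x - a\<bar>)"

text \<open>Comparison with the integral of |x - a| over [0, n], whose antiderivative is P. The
  integrand is 1-Lipschitz, so each unit interval contributes an error of at most 1/2.\<close>

lemma dist_sum_approx:
  assumes "0 \<le> a" "a \<le> real n"
  shows "\<bar>dist_sum n a - ((real n)\<^sup>2 / 4 + (a - real n / 2)\<^sup>2)\<bar> \<le> real n / 2"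
proof -
  define P where "P x = (x - a) * \<bar>x - a\<bar> / 2" for x
  have step: "\<bar>P (z + 1) - P z - \<bar>z - a\<bar>\<bar> \<le> 1 / 2" for z
  proof -
    consider "z - a \<ge> 0" | "z - a \<le> -1" | "-1 < z - a" "z - a < 0" by linarith
    then show ?thesis
    proof cases
      \<comment> \<open>The kink of |x - a| lies inside the unit interval.\<close>
      case 3
      then have "\<bar>z + 1 - a\<bar> = z + 1 - a" "\<bar>z - a\<bar> = a - z" by linarith+
      then have "P (z + 1) - P z - \<bar>z - a\<bar> = (z - a + 1)\<^sup>2 - 1 / 2"
        by (simp add: P_def power2_eq_square add_divide_distrib diff_divide_distrib algebra_simps)
      moreover have "(z - a + 1)\<^sup>2 \<le> 1" using 3 by (simp add: power_le_one)
      moreover have "0 \<le> (z - a + 1)\<^sup>2" by simp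
      ultimately show ?thesis by linarith
    qed (simp_all add: P_def field_simps)
  qed
  then have "\<bar>P (real (Suc x)) - P (real x) - \<bar>real x - a\<bar>\<bar> \<le> 1 / 2" for x
    using step[of "real x"] by (simp add: add.commute)
  then have "\<bar>\<Sum>x<n. P (real (Suc x)) - P (real x) - \<bar>real x - a\<bar>\<bar> \<le> (\<Sum>x<n. 1 / 2)"
    by (intro order.trans[OF sum_abs] sum_mono)
  moreover have "(\<Sum>x<n. P (real (Suc x)) - P (real x) - \<bar>real x - a\<bar>) = P n - P 0 - dist_sum n a"
    using sum_lessThan_telescope[of "\<lambda>x. P (real x)" n] by (simp add: sum_subtractf dist_sum_def)
  moreover have "P n - P 0 = (real n)\<^sup>2 / 4 + (a - real n / 2)\<^sup>2"
    using assms by (simp add: P_def power2_eq_square field_simps)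
  ultimately show ?thesis by (simp add: abs_minus_commute)
qed

text \<open>
  Expresses the minimum by single distances, so that the Voronoi cells of the two centres need
  not be described.
\<close>

lemma min_abs_eq:
  fixes a c s t x :: real
  assumes "\<bar>t - s\<bar> \<le> c - a"
  shows "min (\<bar>x - a\<bar> + s) (\<bar>x - c\<bar> + t) =
    \<bar>x - a\<bar> + \<bar>x - c\<bar> - \<bar>x - ((a + c) / 2 + (t - s) / 2)\<bar> + (s + t - (c - a)) / 2"
proof (cases "\<bar>x - a\<bar> + s \<le> \<bar>x - c\<bar> + t")
  case True
  then show ?thesis using assms unfolding min_absorb1[OF True] add_divide_distrib diff_divide_distrib by linarith
next
  case False
  then have le: "\<bar>x - c\<bar> + t \<le> \<bar>x - a\<bar> + s" by simp
  then show ?thesis using assms unfolding min_absorb2[OF le] add_divide_distrib diff_divide_distrib by linarith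
qed

text \<open>The objective of the 2-median problem for the l1 metric, summed row by row.\<close>

definition median_cost :: "nat \<Rightarrow> real \<times> real \<Rightarrow> real \<times> real \<Rightarrow> real" where
  "median_cost n p q = (\<Sum>y<n. \<Sum>x<n. min (\<bar>real x - fst p\<bar> + \<bar>real y - snd p\<bar>)
     (\<bar>real x - fst q\<bar> + \<bar>real y - snd q\<bar>))"

text \<open>In row y the two cells meet at x = (a + c) / 2 + (|y - d| - |y - b|) / 2. The assumption
  places this point between a and c, so \<open>min_abs_eq\<close> applies to every row.\<close>

lemma median_cost_eq:
  assumes "\<bar>d - b\<bar> \<le> c - a"
  shows "median_cost n (a, b) (c, d) = n * (dist_sum n a + dist_sum n c)
    - (\<Sum>y<n. dist_sum n ((a + c) / 2 + (\<bar>real y - d\<bar> - \<bar>real y - b\<bar>) / 2))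
    + n * (dist_sum n b + dist_sum n d) / 2 - n\<^sup>2 * (c - a) / 2"
proof -
  have "\<bar>\<bar>real y - d\<bar> - \<bar>real y - b\<bar>\<bar> \<le> c - a" for y using assms by linarith
  then have "median_cost n (a, b) (c, d) = (\<Sum>y<n. \<Sum>x<n. \<bar>real x - a\<bar> + \<bar>real x - c\<bar>
      - \<bar>real x - ((a + c) / 2 + (\<bar>real y - d\<bar> - \<bar>real y - b\<bar>) / 2)\<bar>
      + (\<bar>real y - b\<bar> + \<bar>real y - d\<bar> - (c - a)) / 2)"
    unfolding median_cost_def fst_conv snd_conv by (intro sum.cong refl min_abs_eq)
  also have "\<dots> = (\<Sum>y<n. dist_sum n a + dist_sum n c
      - dist_sum n ((a + c) / 2 + (\<bar>real y - d\<bar> - \<bar>real y - b\<bar>) / 2)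
      + n * ((\<bar>real y - b\<bar> + \<bar>real y - d\<bar> - (c - a)) / 2))"
    by (simp only: sum.distrib sum_subtractf dist_sum_def[symmetric]) simp
  also have "\<dots> = n * (dist_sum n a + dist_sum n c)
    - (\<Sum>y<n. dist_sum n ((a + c) / 2 + (\<bar>real y - d\<bar> - \<bar>real y - b\<bar>) / 2))
    + n * ((dist_sum n b + dist_sum n d - n * (c - a)) / 2)"
    by (simp add: sum.distrib sum_subtractf dist_sum_def sum_distrib_left[symmetric] sum_divide_distrib[symmetric])
  finally show ?thesis by (simp add: field_simps power2_eq_square)
qed

text \<open>Replacing \<open>dist_sum\<close> by the quadratic Q costs O(n^2) in total and leaves a
  polynomial inequality in the coordinates of the centres.\<close>

lemma median_cost_ge_aux:
  assumes n: "n > 0" and ge: "0 \<le> a" "a \<le> n" "0 \<le> b" "b \<le> n" "0 \<le> c" "c \<le> n" "0 \<le> d" "d \<le> n"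
    and le: "\<bar>d - b\<bar> \<le> c - a"
  shows "median_cost n (a, b) (c, d) \<ge> 3 / 8 * n ^ 3 - 5 / 2 * n\<^sup>2"
proof -
  define N where "N = real n"
  define Q where "Q a = N\<^sup>2 / 4 + (a - N / 2)\<^sup>2" for a
  define h where "h y = \<bar>real y - d\<bar> - \<bar>real y - b\<bar>" for y :: nat
  define \<nu> where "\<nu> = (a + c) / 2 - N / 2"
  have N: "N > 0" using n by (simp add: N_def)
  have Q: "\<bar>dist_sum n z - Q z\<bar> \<le> N / 2" if "0 \<le> z" "z \<le> N" for z
    unfolding Q_def N_def using dist_sum_approx[of z n] that by (simp add: N_def)
  have Qa: "\<bar>dist_sum n a - Q a\<bar> \<le> N / 2" and Qb: "\<bar>dist_sum n b - Q b\<bar> \<le> N / 2"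
    and Qc: "\<bar>dist_sum n c - Q c\<bar> \<le> N / 2" and Qd: "\<bar>dist_sum n d - Q d\<bar> \<le> N / 2"
    by (rule Q; use ge in \<open>simp add: N_def\<close>)+
  have h: "\<bar>h y\<bar> \<le> \<bar>d - b\<bar>" for y unfolding h_def by linarith
  have m: "0 \<le> (a + c) / 2 + h y / 2" "(a + c) / 2 + h y / 2 \<le> N" for y
    using h[of y] ge le unfolding N_def add_divide_distrib by - linarith+
  have \<nu>: "\<bar>\<nu>\<bar> \<le> N / 2" using ge by (auto simp: \<nu>_def N_def abs_if)
  have "(\<Sum>y<n. dist_sum n ((a + c) / 2 + h y / 2)) \<le> (\<Sum>y<n. Q ((a + c) / 2 + h y / 2) + N / 2)"
    by (intro sum_mono) (use Q[OF m] in \<open>auto simp only: abs_le_iff diff_le_eq add.commute\<close>)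
  \<comment> \<open>Only the square of h is replaced by its maximal value. The linear term is kept,
    since its sum over y is a difference of two distance sums.\<close>
  also have "\<dots> \<le> (\<Sum>y<n. N\<^sup>2 / 4 + \<nu>\<^sup>2 + \<nu> * h y + (d - b)\<^sup>2 / 4 + N / 2)"
  proof (intro sum_mono)
    fix y
    have "(h y)\<^sup>2 \<le> (d - b)\<^sup>2" using h[of y] by (simp add: abs_le_square_iff)
    moreover have "Q ((a + c) / 2 + h y / 2) = N\<^sup>2 / 4 + \<nu>\<^sup>2 + \<nu> * h y + (h y)\<^sup>2 / 4"
      by (simp add: Q_def \<nu>_def power2_eq_square field_simps)
    ultimately show "Q ((a + c) / 2 + h y / 2) + N / 2 \<le> N\<^sup>2 / 4 + \<nu>\<^sup>2 + \<nu> * h y + (d - b)\<^sup>2 / 4 + N / 2"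
      by simp
  qed
  also have "\<dots> = (\<Sum>y<n. (N\<^sup>2 / 4 + \<nu>\<^sup>2 + (d - b)\<^sup>2 / 4 + N / 2) + \<nu> * h y)"
    by (simp add: algebra_simps)
  also have "\<dots> = N * (N\<^sup>2 / 4 + \<nu>\<^sup>2 + (d - b)\<^sup>2 / 4 + N / 2) + \<nu> * (\<Sum>y<n. h y)"
    by (simp add: sum.distrib sum_distrib_left N_def)
  also have "(\<Sum>y<n. h y) = dist_sum n d - dist_sum n b"
    by (simp add: h_def dist_sum_def sum_subtractf)
  also have "\<nu> * (dist_sum n d - dist_sum n b) \<le> \<nu> * (Q d - Q b) + N\<^sup>2 / 2"
  proof -
    have "\<bar>(dist_sum n d - dist_sum n b) - (Q d - Q b)\<bar> \<le> N"
      using Qd Qb by linarith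
    then have "\<bar>\<nu>\<bar> * \<bar>(dist_sum n d - dist_sum n b) - (Q d - Q b)\<bar> \<le> (N / 2) * N"
      using \<nu> N by (intro mult_mono) auto
    then have "\<bar>\<nu> * ((dist_sum n d - dist_sum n b) - (Q d - Q b))\<bar> \<le> N\<^sup>2 / 2"
      by (simp add: abs_mult power2_eq_square)
    then have "\<nu> * ((dist_sum n d - dist_sum n b) - (Q d - Q b)) \<le> N\<^sup>2 / 2" by linarith
    then show ?thesis by (simp only: right_diff_distrib)
  qed
  finally have sum: "(\<Sum>y<n. dist_sum n ((a + c) / 2 + h y / 2)) \<le>
      N * (N\<^sup>2 / 4 + \<nu>\<^sup>2 + (d - b)\<^sup>2 / 4 + N / 2) + \<nu> * (Q d - Q b) + N\<^sup>2 / 2" by simp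
  have "N * (dist_sum n a + dist_sum n c) \<ge> N * (Q a + Q c - N)"
    using Qa Qc N by (intro mult_left_mono) linarith+
  moreover have "N * (dist_sum n b + dist_sum n d) / 2 \<ge> N * (Q b + Q d - N) / 2"
    using Qb Qd N by (intro divide_right_mono mult_left_mono) linarith+
  ultimately have "median_cost n (a, b) (c, d) \<ge> N * (Q a + Q c - N)
      - (N * (N\<^sup>2 / 4 + \<nu>\<^sup>2 + (d - b)\<^sup>2 / 4 + N / 2) + \<nu> * (Q d - Q b) + N\<^sup>2 / 2)
      + N * (Q b + Q d - N) / 2 - N\<^sup>2 * (c - a) / 2" (is "_ \<ge> ?L")
    using sum unfolding median_cost_eq[OF le] h_def N_def by simp
  \<comment> \<open>The identity (b - N/2)^2 / 2 + (d - N/2)^2 / 2 - (d - b)^2 / 4 = (N - b - d)^2 /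
    4 absorbs the loss from bounding h. All extra terms vanish for c - a = N/2, a + c = N and b + d
    = N.\<close>
  moreover have "?L = 3 / 8 * N ^ 3 - 5 / 2 * N\<^sup>2 + 2 * N * ((c - a) / 2 - N / 4)\<^sup>2
      + (N * \<nu>\<^sup>2 + \<nu> * (N - b - d) * (d - b) + N * (N - b - d)\<^sup>2 / 4)"
    by (simp add: Q_def \<nu>_def power2_eq_square power3_eq_cube field_simps)
  \<comment> \<open>Since |d - b| is at most N, the mixed term is dominated, and N (|\<nu>| - |N - b
    - d| / 2)^2 remains as a lower bound.\<close>
  moreover have "N * \<nu>\<^sup>2 + \<nu> * (N - b - d) * (d - b) + N * (N - b - d)\<^sup>2 / 4 \<ge> 0"
  proof -
    have "\<bar>\<nu> * (N - b - d) * (d - b)\<bar> \<le> \<bar>\<nu> * (N - b - d)\<bar> * N"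
      unfolding abs_mult using ge by (intro mult_left_mono) (auto simp: N_def abs_if)
    moreover have "N * x\<^sup>2 - \<bar>x * w\<bar> * N + N * w\<^sup>2 / 4 \<ge> 0" for x w
    proof -
      have "(\<bar>x\<bar> - \<bar>w\<bar> / 2)\<^sup>2 = x\<^sup>2 - \<bar>x * w\<bar> + w\<^sup>2 / 4"
        by (simp add: power2_diff power_divide abs_mult)
      then have "0 \<le> N * (x\<^sup>2 - \<bar>x * w\<bar> + w\<^sup>2 / 4)" using N by (metis mult_nonneg_nonneg less_imp_le zero_le_power2)
      then show ?thesis by (simp add: algebra_simps)
    qed
    note this[of \<nu> "N - b - d"]
    ultimately show ?thesis by linarith
  qed
  moreover have "2 * N * ((c - a) / 2 - N / 4)\<^sup>2 \<ge> 0" using N by simp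
  ultimately show ?thesis unfolding N_def by linarith
qed

lemma median_cost_commute: "median_cost n p q = median_cost n q p"
  by (simp add: median_cost_def min.commute)

lemma median_cost_swap: "median_cost n (a, b) (c, d) = median_cost n (b, a) (d, c)"
  unfolding median_cost_def by (subst sum.swap) (simp add: add.commute)

text \<open>Exchanging the centres or the axes reduces to the case that the first coordinates are
  separated at least as much as the second ones, with a to the left of c.\<close>

lemma median_cost_ge:
  assumes "n > 0" "0 \<le> a" "a \<le> n" "0 \<le> b" "b \<le> n" "0 \<le> c" "c \<le> n" "0 \<le> d" "d \<le> n"
  shows "median_cost n (a, b) (c, d) \<ge> 3 / 8 * n ^ 3 - 5 / 2 * n\<^sup>2"
proof -
  consider "\<bar>d - b\<bar> \<le> c - a" | "\<bar>b - d\<bar> \<le> a - c" | "\<bar>c - a\<bar> \<le> d - b" | "\<bar>a - c\<bar> \<le> b - d" by linarith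
  then show ?thesis
  proof cases
    case 1 with assms show ?thesis by (intro median_cost_ge_aux)
  next
    case 2 with assms show ?thesis by (subst median_cost_commute) (intro median_cost_ge_aux)
  next
    case 3 with assms show ?thesis by (subst median_cost_swap) (intro median_cost_ge_aux)
  next
    case 4 with assms show ?thesis
      by (subst median_cost_swap, subst median_cost_commute) (intro median_cost_ge_aux)
  qed
qed

text \<open>These centres make the squares of the lower bound vanish, up to rounding, which costs
  O(n^2). With equal second coordinates the cells are separated by a vertical line.\<close>

lemma median_cost_le:
  assumes n: "n > 0"
  shows "median_cost n (real (n div 4), real (n div 2)) (real (3 * n div 4), real (n div 2)) \<le> 3 / 8 * n ^ 3 + 7 * n\<^sup>2"
proof -
  define N where "N = real n"
  define a b c where "a = real (n div 4)" and "b = real (n div 2)" and "c = real (3 * n div 4)"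
  have N: "N \<ge> 1" using n by (simp add: N_def)
  have "4 * (n div 4) \<le> n" "n < 4 * (n div 4) + 4" "2 * (n div 2) \<le> n" "n < 2 * (n div 2) + 2"
    "4 * (3 * n div 4) \<le> 3 * n" "3 * n < 4 * (3 * n div 4) + 4" by linarith+
  then have a: "N / 4 - 1 \<le> a" "a \<le> N / 4" and b: "N / 2 - 1 \<le> b" "b \<le> N / 2"
    and c: "3 * N / 4 - 1 \<le> c" "c \<le> 3 * N / 4" and nn: "0 \<le> a" "0 \<le> b" "0 \<le> c" and "a \<le> c"
    unfolding N_def a_def b_def c_def by (auto simp: div_le_mono)
  have Q: "dist_sum n z \<le> N\<^sup>2 / 4 + (z - N / 2)\<^sup>2 + N / 2" "dist_sum n z \<ge> N\<^sup>2 / 4 + (z - N / 2)\<^sup>2 - N / 2"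
    if "0 \<le> z" "z \<le> N" for z
    using dist_sum_approx[of z n] that unfolding N_def by linarith+
  have "(a - N / 2)\<^sup>2 \<le> (N / 4 + 1)\<^sup>2"
  proof -
    have "\<bar>a - N / 2\<bar> \<le> \<bar>N / 4 + 1\<bar>" using a N by linarith
    then show ?thesis by (simp add: abs_le_square_iff)
  qed
  with Q(1)[of a] nn a have Qa: "dist_sum n a \<le> N\<^sup>2 / 4 + (N / 4 + 1)\<^sup>2 + N / 2" by linarith
  have "(c - N / 2)\<^sup>2 \<le> (N / 4 + 1)\<^sup>2"
  proof -
    have "\<bar>c - N / 2\<bar> \<le> \<bar>N / 4 + 1\<bar>" using c N by linarith
    then show ?thesis by (simp add: abs_le_square_iff)
  qed
  with Q(1)[of c] nn c have Qc: "dist_sum n c \<le> N\<^sup>2 / 4 + (N / 4 + 1)\<^sup>2 + N / 2" by linarith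
  have "(b - N / 2)\<^sup>2 \<le> 1\<^sup>2"
  proof -
    have "\<bar>b - N / 2\<bar> \<le> \<bar>1\<bar>" using b by linarith
    then show ?thesis by (simp only: abs_le_square_iff)
  qed
  with Q(1)[of b] nn b have Qb: "dist_sum n b \<le> N\<^sup>2 / 4 + 1 + N / 2" by simp
  have "0 \<le> (a + c) / 2" "(a + c) / 2 \<le> N" using nn a c N unfolding add_divide_distrib by - linarith+
  then have Qm: "dist_sum n ((a + c) / 2) \<ge> N\<^sup>2 / 4 - N / 2"
    using Q(2)[of "(a + c) / 2"] nn a c zero_le_power2[of "(a + c) / 2 - N / 2"] by linarith
  have "median_cost n (a, b) (c, b) = N * (dist_sum n a + dist_sum n c - dist_sum n ((a + c) / 2) + dist_sum n b)
      - N\<^sup>2 * (c - a) / 2"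
    using median_cost_eq[of b b c a n] \<open>a \<le> c\<close> by (simp add: N_def algebra_simps)
  also have "\<dots> \<le> N * (2 * (N\<^sup>2 / 4 + (N / 4 + 1)\<^sup>2 + N / 2) - (N\<^sup>2 / 4 - N / 2) + (N\<^sup>2 / 4 + 1 + N / 2))
      - N\<^sup>2 * (N / 2 - 1) / 2"
  proof -
    define X where "X = N\<^sup>2 / 4 + (N / 4 + 1)\<^sup>2 + N / 2"
    have "N * (dist_sum n a + dist_sum n c - dist_sum n ((a + c) / 2) + dist_sum n b) \<le>
        N * (2 * X - (N\<^sup>2 / 4 - N / 2) + (N\<^sup>2 / 4 + 1 + N / 2))"
      using N Qa[folded X_def] Qb Qc[folded X_def] Qm by (intro mult_left_mono) linarith+
    moreover have "N\<^sup>2 * (N / 2 - 1) \<le> N\<^sup>2 * (c - a)"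
      using a c by (intro mult_left_mono) auto
    ultimately show ?thesis unfolding X_def[symmetric] by linarith
  qed
  also have "\<dots> = 3 / 8 * N ^ 3 + 7 / 2 * N\<^sup>2 + 3 * N"
    by (simp add: power2_eq_square power3_eq_cube field_simps)
  also have "\<dots> \<le> 3 / 8 * N ^ 3 + 6 * N\<^sup>2 + N\<^sup>2 "
  proof -
    have "N * 1 \<le> N * N" using N by (intro mult_left_mono) auto
    then show ?thesis unfolding power2_eq_square using N by linarith
  qed
  finally show ?thesis unfolding N_def a_def b_def c_def by simp
qed

section \<open>Displacement of the random walk\<close>

abbreviation nbrs :: "nat \<Rightarrow> nat \<times> nat \<Rightarrow> (nat \<times> nat) set" where
  "nbrs n u \<equiv> {v. (u, v) \<in> parcs (grid n)}"

lemma nbrs_eq: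
  assumes "(a, b) \<in> pverts (grid n)"
  shows "nbrs n (a, b) = (if Suc a < n then {(Suc a, b)} else {}) \<union> (if 0 < a then {(a - 1, b)} else {})
    \<union> (if Suc b < n then {(a, Suc b)} else {}) \<union> (if 0 < b then {(a, b - 1)} else {})"
proof -
  have "((a, b), (c, d)) \<in> parcs (grid n) \<longleftrightarrow> c < n \<and> d < n \<and>
      (a = c \<and> (d = Suc b \<or> b = Suc d) \<or> b = d \<and> (c = Suc a \<or> a = Suc c))" for c d
    using assms by (auto simp: grid_def cartesian_product_def path_graph_def)
  moreover have "v \<in> (if P then {x} else {}) \<longleftrightarrow> P \<and> v = x" for v x :: "nat \<times> nat" and P
    by simp
  moreover have "c < n \<and> d < n \<and> (a = c \<and> (d = Suc b \<or> b = Suc d) \<or> b = d \<and> (c = Suc a \<or> a = Suc c)) \<longleftrightarrow>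
      ((Suc a < n \<and> c = Suc a \<and> d = b \<or> 0 < a \<and> c = a - 1 \<and> d = b) \<or> Suc b < n \<and> c = a \<and> d = Suc b)
      \<or> 0 < b \<and> c = a \<and> d = b - 1" for c d
    using assms by (cases a; cases b; auto simp: pverts_grid_iff)
  ultimately show ?thesis
    by (intro set_eqI) (simp only: split_paired_all mem_Collect_eq Un_iff prod.inject)
qed

lemma sum_nbrs:
  fixes f :: "nat \<times> nat \<Rightarrow> 'b::comm_monoid_add"
  assumes "(a, b) \<in> pverts (grid n)"
  shows "(\<Sum>v\<in>nbrs n (a, b). f v) = (if Suc a < n then f (Suc a, b) else 0) + (if 0 < a then f (a - 1, b) else 0)
    + (if Suc b < n then f (a, Suc b) else 0) + (if 0 < b then f (a, b - 1) else 0)"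
  unfolding nbrs_eq[OF assms]
  by (cases "Suc a < n"; cases "0 < a"; cases "Suc b < n"; cases "0 < b") (simp_all add: ac_simps)

lemma finite_nbrs [simp]: "finite (nbrs n u)"
proof -
  have "nbrs n u \<subseteq> {..<n} \<times> {..<n}" by (auto simp: parcs_grid_iff pverts_grid_iff)
  then show ?thesis by (rule finite_subset) simp
qed

lemma nbrs_nonempty:
  assumes "n \<ge> 2" "u \<in> pverts (grid n)"
  shows "nbrs n u \<noteq> {}"
  using assms by (cases u) (simp only: nbrs_eq, auto simp: pverts_grid_iff)

lemma card_nbrs_le: "u \<in> pverts (grid n) \<Longrightarrow> card (nbrs n u) \<le> 4"
  using sum_nbrs[of "fst u" "snd u" n "\<lambda>_. 1 :: nat"] by simp

text \<open>The assumption does not mention the degree, which is 2, 3 or 4: a drift bound becomes a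
  sign condition on a sum over the neighbours.\<close>

lemma nn_integral_nbrs_le:
  fixes f :: "nat \<times> nat \<Rightarrow> real"
  assumes n: "n \<ge> 2" and u: "u \<in> pverts (grid n)" and f: "\<And>v. 0 \<le> f v"
    and le: "(\<Sum>v\<in>nbrs n u. f v - r) \<le> 0"
  shows "(\<integral>\<^sup>+v. ennreal (f v) \<partial>pmf_of_set (nbrs n u)) \<le> ennreal r"
proof -
  have c: "card (nbrs n u) > 0" using nbrs_nonempty[OF n u] by (simp add: card_gt_0_iff)
  have "(\<integral>\<^sup>+v. ennreal (f v) \<partial>pmf_of_set (nbrs n u)) = ennreal ((\<Sum>v\<in>nbrs n u. f v) / card (nbrs n u))"
    using c f by (subst nn_integral_pmf_of_set[OF nbrs_nonempty[OF n u] finite_nbrs])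
      (auto simp: sum_nonneg divide_ennreal ennreal_of_nat_eq_real_of_nat)
  also have "\<dots> \<le> ennreal r"
    using le c by (intro ennreal_leI) (simp add: sum_subtractf field_simps)
  finally show ?thesis .
qed

definition sqdist :: "nat \<times> nat \<Rightarrow> nat \<times> nat \<Rightarrow> real" where
  "sqdist u v = (real (fst u) - real (fst v))\<^sup>2 + (real (snd u) - real (snd v))\<^sup>2"

text \<open>In the interior the drift vanishes, and at the boundary the walk is pushed back towards any vertex.\<close>

lemma sqdist_drift:
  assumes n: "n \<ge> 2" and u: "u \<in> pverts (grid n)" and y: "y \<in> pverts (grid n)"
  shows "(\<integral>\<^sup>+v. ennreal (sqdist v y) \<partial>pmf_of_set (nbrs n u)) \<le> ennreal (sqdist u y + 1)"
proof (rule nn_integral_nbrs_le[OF n u])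
  obtain a b where u': "u = (a, b)" by (cases u)
  obtain c d where y': "y = (c, d)" by (cases y)
  have "(if Suc a < n then 2 * (real a - c) else 0) + (if 0 < a then 2 * (real c - a) else 0) \<le> 0"
    if "a < n" "c < n" for a c :: nat
    using that n by auto
  from this[of a c] this[of b d] u y
  have "(if Suc a < n then 2 * (real a - c) else 0) + (if 0 < a then 2 * (real c - a) else 0)
    + (if Suc b < n then 2 * (real b - d) else 0) + (if 0 < b then 2 * (real d - b) else 0) \<le> 0"
    by (simp add: u' y' pverts_grid_iff)
  also have "(if Suc a < n then 2 * (real a - c) else 0) + (if 0 < a then 2 * (real c - a) else 0)
    + (if Suc b < n then 2 * (real b - d) else 0) + (if 0 < b then 2 * (real d - b) else 0)
    = (\<Sum>v\<in>nbrs n u. sqdist v y - (sqdist u y + 1))"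
    unfolding u' y' by (subst sum_nbrs[OF u[unfolded u']])
      (auto simp: sqdist_def power2_eq_square algebra_simps of_nat_diff)
  finally show "(\<Sum>v\<in>nbrs n u. sqdist v y - (sqdist u y + 1)) \<le> 0" .
qed (simp add: sqdist_def)

text \<open>One neighbour is closer to c by 1 and each of the at most three others is farther by at
  most 1, so the mean change is at most (3 - 1) / 4.\<close>

lemma l1_drift:
  assumes n: "n \<ge> 2" and u: "u \<in> pverts (grid n)" and c: "c \<in> pverts (grid n)" and ne: "u \<noteq> c"
  shows "(\<integral>\<^sup>+v. ennreal (real (l1 c v)) \<partial>pmf_of_set (nbrs n u)) \<le> ennreal (real (l1 c u) + 1 / 2)"
proof (rule nn_integral_nbrs_le[OF n u])
  \<comment> \<open>With the roles exchanged, a step of the chase yields the neighbour that is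
    closer to the cop.\<close>
  define w where "w = cop_step n u c"
  have wl: "Suc (l1 w c) = l1 u c" unfolding w_def by (rule l1_cop_step[OF u c ne])
  then have "w \<noteq> u" by auto
  then have w: "w \<in> nbrs n u" using stay_or_move_cop_step[of n u c] by (auto simp: stay_or_move_def w_def)
  have "(\<Sum>v\<in>nbrs n u. real (l1 c v) - (real (l1 c u) + 1 / 2)) =
      (real (l1 c w) - (real (l1 c u) + 1 / 2)) + (\<Sum>v\<in>nbrs n u - {w}. real (l1 c v) - (real (l1 c u) + 1 / 2))"
    using w by (subst sum.remove[of _ w]) auto
  also have "(\<Sum>v\<in>nbrs n u - {w}. real (l1 c v) - (real (l1 c u) + 1 / 2)) \<le> (\<Sum>v\<in>nbrs n u - {w}. 1 / 2)"
  proof (rule sum_mono)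
    fix v assume "v \<in> nbrs n u - {w}"
    then have "l1 u v = 1" by (simp add: parcs_grid_iff)
    with l1_triangle[of c v u] show "real (l1 c v) - (real (l1 c u) + 1 / 2) \<le> 1 / 2" by linarith
  qed
  also have "\<dots> = (real (card (nbrs n u)) - 1) / 2"
  proof -
    have "card (nbrs n u) \<ge> 1" using w by (metis One_nat_def Suc_leI card_gt_0_iff empty_iff finite_nbrs)
    then show ?thesis using w by (simp add: card_Diff_singleton of_nat_diff)
  qed
  also have "real (l1 c w) - (real (l1 c u) + 1 / 2) = - 3 / 2"
    using wl by (simp add: l1_commute[of c])
  finally show "(\<Sum>v\<in>nbrs n u. real (l1 c v) - (real (l1 c u) + 1 / 2)) \<le> 0"
    using card_nbrs_le[OF u] unfolding diff_divide_distrib by linarith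
qed simp

lemma AE_grid_walk:
  assumes n: "n \<ge> 2" and y: "y \<in> pverts (grid n)"
  shows "AE Y in random_walk (grid n) y. Y 0 = y \<and> (\<forall>t. Y t \<in> pverts (grid n) \<and> (Y t, Y (Suc t)) \<in> parcs (grid n))"
proof -
  have "\<exists>v. (u, v) \<in> parcs (grid n)" if "u \<in> pverts (grid n)" for u
    using nbrs_nonempty[OF n that] by blast
  then have "AE Y in random_walk (grid n) y. \<forall>t. Y t \<in> pverts (grid n) \<and> (Y t, Y (Suc t)) \<in> parcs (grid n)"
    by (intro AE_random_walk_verts_arcs pair_graph_grid y)
  with AE_random_walk_0[where G = "grid n" and y = y]
  show ?thesis by eventually_elim simp
qed

text \<open>Reduces an expected one-step inequality to each single history of vertices, ending at
  the current position.\<close>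

lemma nn_integral_grid_walk_Suc_le:
  assumes n: "n \<ge> 2" and y: "y \<in> pverts (grid n)"
    and le: "\<And>h. h \<noteq> [] \<Longrightarrow> length h = Suc t \<Longrightarrow> set h \<subseteq> pverts (grid n) \<Longrightarrow>
      (\<integral>\<^sup>+v. f (h @ [v]) \<partial>pmf_of_set (nbrs n (last h))) \<le> g h"
  shows "(\<integral>\<^sup>+Y. f (map Y [0..<Suc (Suc t)]) \<partial>random_walk (grid n) y) \<le>
    (\<integral>\<^sup>+Y. g (map Y [0..<Suc t]) \<partial>random_walk (grid n) y)"
  unfolding nn_integral_random_walk_step
proof (rule nn_integral_mono_AE, use AE_grid_walk[OF n y] in eventually_elim)
  case (elim Y)
  then show ?case using le[of "map Y [0..<Suc t]"] by (auto simp: last_map)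
qed

lemma second_moment:
  assumes n: "n \<ge> 2" and y: "y \<in> pverts (grid n)"
  shows "(\<integral>\<^sup>+Y. ennreal (sqdist (Y t) y) \<partial>random_walk (grid n) y) \<le> ennreal (real t)"
proof (induction t)
  case 0
  have "(\<integral>\<^sup>+Y. ennreal (sqdist (Y 0) y) \<partial>random_walk (grid n) y) = (\<integral>\<^sup>+Y. 0 \<partial>random_walk (grid n) y)"
    by (rule nn_integral_cong_AE, use AE_grid_walk[OF n y] in eventually_elim) (simp add: sqdist_def)
  then show ?case by simp
next
  case (Suc t)
  have plus_1: "ennreal (r + 1) = ennreal r + 1" if "r \<ge> 0" for r
    using that by simp
  have "(\<integral>\<^sup>+Y. ennreal (sqdist (last (map Y [0..<Suc (Suc t)])) y) \<partial>random_walk (grid n) y) \<le>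
    (\<integral>\<^sup>+Y. ennreal (sqdist (last (map Y [0..<Suc t])) y + 1) \<partial>random_walk (grid n) y)"
  proof (rule nn_integral_grid_walk_Suc_le[OF n y])
    fix h :: "(nat \<times> nat) list" assume "h \<noteq> []" "set h \<subseteq> pverts (grid n)"
    then have "last h \<in> pverts (grid n)" using last_in_set by blast
    then show "(\<integral>\<^sup>+v. ennreal (sqdist (last (h @ [v])) y) \<partial>pmf_of_set (nbrs n (last h))) \<le>
        ennreal (sqdist (last h) y + 1)"
      using sqdist_drift[OF n _ y] by simp
  qed
  also have "\<dots> = (\<integral>\<^sup>+Y. ennreal (sqdist (last (map Y [0..<Suc t])) y) + 1 \<partial>random_walk (grid n) y)"
    by (simp add: plus_1 sqdist_def del: upt_Suc)
  also have "\<dots> = (\<integral>\<^sup>+Y. ennreal (sqdist (last (map Y [0..<Suc t])) y) \<partial>random_walk (grid n) y) + 1"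
    using borel_measurable_random_walk[of "\<lambda>h. ennreal (sqdist (last h) y)" "Suc t"]
    by (simp add: nn_integral_add del: upt_Suc)
  also have "\<dots> \<le> ennreal (real t) + 1" using Suc by (simp add: last_map)
  also have "\<dots> = ennreal (real (Suc t))" using plus_1[of "real t"] by (simp add: add.commute)
  finally show ?case by (simp add: last_map)
qed

text \<open>Instead of the Cauchy-Schwarz inequality, |z| \<le> z^2 / (2 s) + s / 2 with s = sqrt n
  is applied to both coordinates. The range t \<le> 2 n covers all distances in the grid.\<close>

lemma first_moment:
  assumes n: "n \<ge> 2" and y: "y \<in> pverts (grid n)" and t: "t \<le> 2 * n"
  shows "(\<integral>\<^sup>+Y. ennreal (real (l1 (Y t) y)) \<partial>random_walk (grid n) y) \<le> ennreal (2 * sqrt n)"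
proof -
  define s where "s = sqrt (real n)"
  have s: "s > 0" "s * s = n" using n by (auto simp: s_def)
  have abs: "\<bar>z\<bar> \<le> z\<^sup>2 / (2 * s) + s / 2" for z
  proof -
    have "0 \<le> (\<bar>z\<bar> - s)\<^sup>2" by simp
    then have "\<bar>z\<bar> * (2 * s) \<le> z\<^sup>2 + s\<^sup>2" by (simp add: power2_diff mult_ac)
    then have "\<bar>z\<bar> \<le> (z\<^sup>2 + s\<^sup>2) / (2 * s)" using s(1) by (simp add: pos_le_divide_eq)
    then show ?thesis using s(1) by (simp add: add_divide_distrib power2_eq_square)
  qed
  have "real (l1 u y) \<le> sqdist u y / (2 * s) + s" for u
    using abs[of "real (fst u) - real (fst y)"] abs[of "real (snd u) - real (snd y)"]
    by (simp add: l1_def sqdist_def add_divide_distrib)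
  then have "(\<integral>\<^sup>+Y. ennreal (real (l1 (Y t) y)) \<partial>random_walk (grid n) y) \<le>
      (\<integral>\<^sup>+Y. ennreal (1 / (2 * s)) * ennreal (sqdist (last (map Y [0..<Suc t])) y) + ennreal s \<partial>random_walk (grid n) y)"
    using s by (intro nn_integral_mono)
      (simp add: last_map ennreal_mult[symmetric] ennreal_plus[symmetric] sqdist_def ennreal_leI del: ennreal_plus)
  also have "\<dots> = ennreal (1 / (2 * s)) * (\<integral>\<^sup>+Y. ennreal (sqdist (last (map Y [0..<Suc t])) y) \<partial>random_walk (grid n) y) + ennreal s"
    using borel_measurable_random_walk[of "\<lambda>h. ennreal (sqdist (last h) y)" "Suc t"]
    by (simp add: nn_integral_add nn_integral_cmult del: upt_Suc)
  also have "\<dots> \<le> ennreal (1 / (2 * s)) * ennreal (real t) + ennreal s"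
    using second_moment[OF n y, of t] by (intro add_mono mult_left_mono) (auto simp: last_map)
  also have "\<dots> = ennreal (real t / (2 * s) + s)"
    using s by (simp add: ennreal_mult[symmetric] ennreal_plus[symmetric] del: ennreal_plus)
  also have "\<dots> \<le> ennreal (2 * s)"
  proof (rule ennreal_leI)
    have "real t \<le> 2 * (s * s)" using t s(2) by simp
    then have "real t / (2 * s) \<le> s" using s(1) by (simp add: field_simps)
    then show "real t / (2 * s) + s \<le> 2 * s" by simp
  qed
  finally show ?thesis by (simp add: s_def)
qed

section \<open>The expected capture time\<close>

text \<open>The pathwise form of the tail formula for expectations, with the first D rounds counted
  in full. P may be any event implied by survival; if m is infinite, all P k hold and the sum
  diverges.\<close>

lemma ennreal_of_enat_le_suminf:
  fixes m :: enat
  assumes "\<And>k. enat (D + k) < m \<Longrightarrow> P k"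
  shows "ennreal_of_enat m \<le> of_nat D + (\<Sum>k. if P k then 1 else 0)"
proof -
  have *: "of_nat K \<le> of_nat D + (\<Sum>k. if P k then 1 else 0 :: ennreal)" if "enat K \<le> m" for K
  proof -
    have P: "P k" if "k < K - D" for k
    proof (rule assms)
      have "enat (D + k) < enat K" using that by simp
      then show "enat (D + k) < m" using \<open>enat K \<le> m\<close> by (rule less_le_trans)
    qed
    have "(of_nat K :: ennreal) \<le> of_nat (D + (K - D))" unfolding of_nat_le_iff by simp
    also have "\<dots> = of_nat D + (\<Sum>k<K - D. if P k then 1 else 0)" using P by simp
    also have "\<dots> \<le> of_nat D + (\<Sum>k. if P k then 1 else 0)"
      by (intro add_left_mono sum_le_suminf) auto
    finally show ?thesis .
  qed
  show ?thesis
  proof (cases m)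
    case (enat K)
    then show ?thesis using *[of K] by simp
  next
    case infinity
    show ?thesis
    proof (rule ccontr)
      assume "\<not> ?thesis"
      then have "of_nat D + (\<Sum>k. if P k then 1 else 0) < ennreal_of_enat m" by (rule not_le_imp_less)
      then have "of_nat D + (\<Sum>k. if P k then 1 else 0) < (top :: ennreal)"
        by (rule order.strict_trans2) simp
      then obtain K where "of_nat D + (\<Sum>k. if P k then 1 else 0) < (of_nat K :: ennreal)"
        using ennreal_Ex_less_of_nat by blast
      with *[of K] infinity show False by simp
    qed
  qed
qed

text \<open>The cop first walks to the initial vertex of the robber, which takes D rounds, and chases him from then on.\<close>

definition delayed_chase :: "nat \<Rightarrow> nat \<Rightarrow> nat \<times> nat \<Rightarrow> nat \<times> nat \<Rightarrow> (nat \<times> nat) list \<Rightarrow> nat \<times> nat" where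
  "delayed_chase n D y c h = chase n c (replicate (min D (length h)) y @ drop D h)"

lemma delayed_chase_simps:
  "delayed_chase n D y c [] = c"
  "delayed_chase n D y c (h @ [v]) = cop_step n (delayed_chase n D y c h) (if length h < D then y else v)"
proof -
  show "delayed_chase n D y c [] = c" by (simp add: delayed_chase_def)
  show "delayed_chase n D y c (h @ [v]) = cop_step n (delayed_chase n D y c h) (if length h < D then y else v)"
  proof (cases "length h < D")
    case True
    then have "min D (length (h @ [v])) = Suc (length h)" "min D (length h) = length h" by auto
    then show ?thesis using True chase_simps(2)[of n c "replicate (length h) y" y]
      by (simp add: delayed_chase_def replicate_append_same)
  next
    case False
    then show ?thesis using chase_simps(2)[of n c "replicate D y @ drop D h" v]
      by (simp add: delayed_chase_def)
  qed
qed

lemma delayed_chase_in_grid: "c \<in> pverts (grid n) \<Longrightarrow> delayed_chase n D y c h \<in> pverts (grid n)"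
  by (simp add: delayed_chase_def chase_in_grid)

lemma l1_delayed_chase:
  assumes "c \<in> pverts (grid n)" "y \<in> pverts (grid n)" "length h \<le> l1 c y"
  shows "l1 (delayed_chase n (l1 c y) y c h) y = l1 c y - length h"
  using assms(3)
proof (induction h rule: rev_induct)
  case (snoc v h)
  then have "delayed_chase n (l1 c y) y c h \<noteq> y" by auto
  from l1_cop_step[OF delayed_chase_in_grid[OF assms(1)] assms(2) this] snoc
  show ?case by (simp add: delayed_chase_simps)
qed (simp add: delayed_chase_simps)

lemma delayed_chase_strategy:
  "(\<lambda>h. x[i := delayed_chase n D y (x ! i) h]) \<in> cop_strategies (grid n) x"
proof -
  have "stay_or_move (grid n) (x[i := delayed_chase n D y (x ! i) h] ! j)
      (x[i := delayed_chase n D y (x ! i) (h @ [v])] ! j)" if "j < length x" for j h v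
    using that by (cases "j = i") (auto simp: delayed_chase_simps stay_or_move_cop_step, simp add: stay_or_move_def)
  then show ?thesis
    by (simp add: cop_strategies_def list_all2_conv_all_nth delayed_chase_simps)
qed

text \<open>A relaxed survival event for one cop: captures before round D, by his move in round D,
  or by other cops are ignored. This can only overestimate the capture time.\<close>

definition uncaught :: "((nat \<times> nat) list \<Rightarrow> nat \<times> nat) \<Rightarrow> nat \<Rightarrow> (nat \<times> nat) list \<Rightarrow> bool" where
  "uncaught C D h \<longleftrightarrow> (\<forall>s. D \<le> s \<longrightarrow> s < length h \<longrightarrow> C (take s h) \<noteq> h ! s \<and> (D < s \<longrightarrow> C (take s h) \<noteq> h ! (s - 1)))"

lemma uncaught_snoc:
  "uncaught C D (h @ [v]) \<longleftrightarrow>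
    uncaught C D h \<and> (D \<le> length h \<longrightarrow> C h \<noteq> v \<and> (D < length h \<longrightarrow> C h \<noteq> last h))"
proof -
  have l: "(h @ [v]) ! (length h - 1) = last h" if "D < length h"
    using that by (cases "h = []") (simp_all add: nth_append last_conv_nth)
  have "uncaught C D (h @ [v]) \<longleftrightarrow> (\<forall>s. D \<le> s \<longrightarrow> s < length h \<longrightarrow> C (take s (h @ [v])) \<noteq> (h @ [v]) ! s \<and>
      (D < s \<longrightarrow> C (take s (h @ [v])) \<noteq> (h @ [v]) ! (s - 1))) \<and>
      (D \<le> length h \<longrightarrow> C (take (length h) (h @ [v])) \<noteq> (h @ [v]) ! length h \<and>
      (D < length h \<longrightarrow> C (take (length h) (h @ [v])) \<noteq> (h @ [v]) ! (length h - 1)))"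
    unfolding uncaught_def length_append_singleton less_Suc_eq by blast
  also have "(D < length h \<longrightarrow> C (take (length h) (h @ [v])) \<noteq> (h @ [v]) ! (length h - 1)) \<longleftrightarrow>
      (D < length h \<longrightarrow> C h \<noteq> last h)"
    by (intro imp_cong refl) (simp only: l, simp)
  also have "(\<forall>s. D \<le> s \<longrightarrow> s < length h \<longrightarrow> C (take s (h @ [v])) \<noteq> (h @ [v]) ! s \<and>
      (D < s \<longrightarrow> C (take s (h @ [v])) \<noteq> (h @ [v]) ! (s - 1))) \<longleftrightarrow> uncaught C D h"
    unfolding uncaught_def by (intro all_cong1 imp_cong refl) (simp add: nth_append less_imp_diff_less)
  finally show ?thesis by (simp add: nth_append)
qed

text \<open>A potential argument: the distance between cop and robber falls by 1/2 in expectation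
  per round survived after round D, so the survival probabilities sum to at most twice the expected
  distance at time D.\<close>

lemma dct_from_le_second_phase:
  assumes n: "n \<ge> 2" and x: "x \<in> cop_positions (grid n) k" and i: "i < length x" and y: "y \<in> pverts (grid n)"
  defines "D \<equiv> l1 (x ! i) y"
  shows "dct_from (grid n) x y \<le> of_nat D + 2 * (\<integral>\<^sup>+Y. ennreal (real (l1 (Y D) y)) \<partial>random_walk (grid n) y)"
proof -
  define C where "C = delayed_chase n D y (x ! i)"
  define \<sigma> where "\<sigma> = (\<lambda>h. x[i := C h])"
  let ?M = "random_walk (grid n) y"
  have \<sigma>: "\<sigma> \<in> cop_strategies (grid n) x" unfolding \<sigma>_def C_def by (rule delayed_chase_strategy)
  have xi: "x ! i \<in> pverts (grid n)" using x i by (auto simp: cop_positions_def)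
  have C: "C h \<in> pverts (grid n)" for h unfolding C_def by (rule delayed_chase_in_grid[OF xi])
  have C_snoc: "C (h @ [v]) = cop_step n (C h) v" if "D \<le> length h" for h v
    using that by (simp add: C_def delayed_chase_simps)
  have C_D: "C h = y" if "length h = D" for h
    using l1_delayed_chase[OF xi y, of h] that by (simp add: C_def D_def)
  \<comment> \<open>The potential, set to 0 after the capture. The cop's position in a round depends
    on the earlier robber positions only, hence \<open>butlast h\<close> against
    \<open>last h\<close>.\<close>
  define W where "W h = (if uncaught C D h then ennreal (real (l1 (C (butlast h)) (last h))) else 0)" for h
  define B where "B h = (if uncaught C D h then 1 else 0 :: ennreal)" for h
  have mB: "(\<lambda>Y. B (map Y [0..<t])) \<in> borel_measurable ?M" for t by (rule borel_measurable_random_walk)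
  have mW: "(\<lambda>Y. W (map Y [0..<t])) \<in> borel_measurable ?M" for t by (rule borel_measurable_random_walk)
  \<comment> \<open>The cop gains 1 by his move and the robber's move gives back at most 1/2 on
    average. If the cop's move already captures, the potential drops to 0.\<close>
  have drift: "(\<integral>\<^sup>+v. W (h @ [v]) + ennreal (1 / 2) * B h \<partial>pmf_of_set (nbrs n (last h))) \<le> W h"
    if h: "h \<noteq> []" "D < length h" "set h \<subseteq> pverts (grid n)" for h
  proof (cases "uncaught C D h")
    case False
    then show ?thesis by (simp add: W_def B_def uncaught_snoc)
  next
    case True
    obtain h' u where h': "h = h' @ [u]" using h(1) by (metis rev_exhaust)
    with h have u: "u \<in> pverts (grid n)" and D: "D \<le> length h'" by auto
    from True D have ne: "C h' \<noteq> u" by (simp add: h' uncaught_snoc)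
    have l1: "Suc (l1 (C h) u) = l1 (C h') u"
      unfolding h' C_snoc[OF D] by (rule l1_cop_step[OF C u ne])
    have "(\<integral>\<^sup>+v. W (h @ [v]) \<partial>pmf_of_set (nbrs n u)) \<le> ennreal (real (l1 (C h) u) + 1 / 2)"
    proof (cases "C h = u")
      case True
      then show ?thesis using h(2) by (simp add: W_def uncaught_snoc) (simp add: h')
    next
      case False
      have "(\<integral>\<^sup>+v. W (h @ [v]) \<partial>pmf_of_set (nbrs n u)) \<le> (\<integral>\<^sup>+v. ennreal (real (l1 (C h) v)) \<partial>pmf_of_set (nbrs n u))"
        by (intro nn_integral_mono) (simp add: W_def)
      also have "\<dots> \<le> ennreal (real (l1 (C h) u) + 1 / 2)"
        using False by (intro l1_drift n u C) auto
      finally show ?thesis .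
    qed
    then have "(\<integral>\<^sup>+v. W (h @ [v]) \<partial>pmf_of_set (nbrs n u)) + ennreal (1 / 2) \<le> ennreal (real (l1 (C h) u) + 1 / 2) + ennreal (1 / 2)"
      by (rule add_right_mono)
    also have "\<dots> = ennreal (real (l1 (C h') u))"
      unfolding l1[symmetric] by (subst ennreal_plus[symmetric]) (auto simp: add.commute)
    finally show ?thesis using True
      by (simp add: h' W_def[of "h' @ [u]"] B_def nn_integral_add)
  qed
  have step: "(\<integral>\<^sup>+Y. W (map Y [0..<Suc (Suc t)]) \<partial>?M) + ennreal (1 / 2) * (\<integral>\<^sup>+Y. B (map Y [0..<Suc t]) \<partial>?M)
      \<le> (\<integral>\<^sup>+Y. W (map Y [0..<Suc t]) \<partial>?M)" if "D \<le> t" for t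
  proof -
    have "(\<integral>\<^sup>+Y. W (map Y [0..<Suc (Suc t)]) \<partial>?M) + ennreal (1 / 2) * (\<integral>\<^sup>+Y. B (map Y [0..<Suc t]) \<partial>?M)
      = (\<integral>\<^sup>+Y. W (map Y [0..<Suc (Suc t)]) + ennreal (1 / 2) * B (map Y [0..<Suc t]) \<partial>?M)"
      using mW[of "Suc (Suc t)"] mB[of "Suc t"] by (simp add: nn_integral_add nn_integral_cmult del: upt_Suc)
    also have "\<dots> = (\<integral>\<^sup>+Y. W (map Y [0..<Suc (Suc t)]) + ennreal (1 / 2) * B (butlast (map Y [0..<Suc (Suc t)])) \<partial>?M)"
      by (simp add: butlast_append)
    also have "\<dots> \<le> (\<integral>\<^sup>+Y. W (map Y [0..<Suc t]) \<partial>?M)"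
      using drift that
      by (intro nn_integral_grid_walk_Suc_le[OF n y, of _ "\<lambda>h. W h + ennreal (1 / 2) * B (butlast h)" W]) auto
    finally show ?thesis .
  qed
  have sum: "(\<integral>\<^sup>+Y. W (map Y [0..<Suc (D + K)]) \<partial>?M) + ennreal (1 / 2) * (\<Sum>k<K. \<integral>\<^sup>+Y. B (map Y [0..<Suc (D + k)]) \<partial>?M)
      \<le> (\<integral>\<^sup>+Y. ennreal (real (l1 (Y D) y)) \<partial>?M)" for K
  proof (induction K)
    case 0
    \<comment> \<open>In round D the cop has arrived at y, so his distance to the robber is the
      displacement of the walk.\<close>
    have "W (map Y [0..<Suc D]) \<le> ennreal (real (l1 (Y D) y))" for Y
      using C_D[of "map Y [0..<D]"] by (simp add: W_def l1_commute)
    then show ?case by (simp add: nn_integral_mono del: upt_Suc)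
  next
    case (Suc K)
    have "(\<integral>\<^sup>+Y. W (map Y [0..<Suc (D + Suc K)]) \<partial>?M) + ennreal (1 / 2) * (\<Sum>k<Suc K. \<integral>\<^sup>+Y. B (map Y [0..<Suc (D + k)]) \<partial>?M)
      = ((\<integral>\<^sup>+Y. W (map Y [0..<Suc (Suc (D + K))]) \<partial>?M) + ennreal (1 / 2) * (\<integral>\<^sup>+Y. B (map Y [0..<Suc (D + K)]) \<partial>?M))
        + ennreal (1 / 2) * (\<Sum>k<K. \<integral>\<^sup>+Y. B (map Y [0..<Suc (D + k)]) \<partial>?M)"
      by (simp add: distrib_left add_ac del: upt_Suc)
    also have "\<dots> \<le> (\<integral>\<^sup>+Y. W (map Y [0..<Suc (D + K)]) \<partial>?M) + ennreal (1 / 2) * (\<Sum>k<K. \<integral>\<^sup>+Y. B (map Y [0..<Suc (D + k)]) \<partial>?M)"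
      by (intro add_right_mono step) simp
    also note Suc
    finally show ?case .
  qed
  have tail: "(\<Sum>k. \<integral>\<^sup>+Y. B (map Y [0..<Suc (D + k)]) \<partial>?M) \<le> 2 * (\<integral>\<^sup>+Y. ennreal (real (l1 (Y D) y)) \<partial>?M)"
  proof (rule suminf_le_const[OF summableI])
    fix K
    let ?S = "(\<Sum>k<K. \<integral>\<^sup>+Y. B (map Y [0..<Suc (D + k)]) \<partial>?M)"
    have "ennreal (1 / 2) * ?S \<le> (\<integral>\<^sup>+Y. ennreal (real (l1 (Y D) y)) \<partial>?M)"
      using sum[of K] by (rule order.trans[rotated]) simp
    then have "2 * (ennreal (1 / 2) * ?S) \<le> 2 * (\<integral>\<^sup>+Y. ennreal (real (l1 (Y D) y)) \<partial>?M)"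
      by (rule mult_left_mono) simp
    moreover have "2 * ennreal (1 / 2) = ennreal (2 * (1 / 2))"
      by (subst ennreal_mult) auto
    ultimately show "?S \<le> 2 * (\<integral>\<^sup>+Y. ennreal (real (l1 (Y D) y)) \<partial>?M)"
      by (simp add: mult.assoc[symmetric])
  qed
  have "ennreal_of_enat (capture_time (cop_trajectory \<sigma> Y) Y) \<le> of_nat D + (\<Sum>k. B (map Y [0..<Suc (D + k)]))" for Y
    unfolding B_def
  proof (rule ennreal_of_enat_le_suminf)
    fix k assume k: "enat (D + k) < capture_time (cop_trajectory \<sigma> Y) Y"
    show "uncaught C D (map Y [0..<Suc (D + k)])"
      unfolding uncaught_def
    proof (intro allI impI)
      fix s assume "s < length (map Y [0..<Suc (D + k)])"
      then have s: "s \<le> D + k" by simp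
      have mem: "C (map Y [0..<s]) \<in> set (cop_trajectory \<sigma> Y s)"
        using i by (simp add: cop_trajectory_def \<sigma>_def set_update_memI)
      have "enat s < capture_time (cop_trajectory \<sigma> Y) Y" using s k by (meson enat_ord_simps(1) le_less_trans)
      then have "\<not> (Y s \<in> set (cop_trajectory \<sigma> Y s) \<or> (s > 0 \<and> Y (s - 1) \<in> set (cop_trajectory \<sigma> Y s)))"
        using capture_time_le leD by blast
      with mem have "C (map Y [0..<s]) \<noteq> Y s \<and> (s > 0 \<longrightarrow> C (map Y [0..<s]) \<noteq> Y (s - 1))" by auto
      moreover have "take s (map Y [0..<Suc (D + k)]) = map Y [0..<s]"
        using s by (simp add: take_map del: upt_Suc)
      moreover have "map Y [0..<Suc (D + k)] ! s = Y s" "map Y [0..<Suc (D + k)] ! (s - 1) = Y (s - 1)"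
        using s by (simp_all del: upt_Suc)
      ultimately show "C (take s (map Y [0..<Suc (D + k)])) \<noteq> map Y [0..<Suc (D + k)] ! s \<and>
          (D < s \<longrightarrow> C (take s (map Y [0..<Suc (D + k)])) \<noteq> map Y [0..<Suc (D + k)] ! (s - 1))"
        by simp
    qed
  qed
  then have "(\<integral>\<^sup>+Y. ennreal_of_enat (capture_time (cop_trajectory \<sigma> Y) Y) \<partial>?M) \<le>
      (\<integral>\<^sup>+Y. of_nat D + (\<Sum>k. B (map Y [0..<Suc (D + k)])) \<partial>?M)" by (rule nn_integral_mono)
  also have "\<dots> = of_nat D + (\<Sum>k. \<integral>\<^sup>+Y. B (map Y [0..<Suc (D + k)]) \<partial>?M)"
    using mB by (simp add: nn_integral_add nn_integral_suminf del: upt_Suc)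
  also have "\<dots> \<le> of_nat D + 2 * (\<integral>\<^sup>+Y. ennreal (real (l1 (Y D) y)) \<partial>?M)"
    by (intro add_left_mono tail)
  finally show ?thesis unfolding dct_from_def by (rule INF_lower2[OF \<sigma>])
qed

lemma l1_le: "u \<in> pverts (grid n) \<Longrightarrow> v \<in> pverts (grid n) \<Longrightarrow> l1 u v \<le> 2 * n"
  by (auto simp: l1_def pverts_grid_iff nat_le_iff)

lemma dct_from_le:
  assumes n: "n \<ge> 2" and x: "x \<in> cop_positions (grid n) k" and i: "i < length x" and y: "y \<in> pverts (grid n)"
  shows "dct_from (grid n) x y \<le> ennreal (real (l1 (x ! i) y) + 4 * sqrt n)"
proof -
  have xi: "x ! i \<in> pverts (grid n)" using x i by (auto simp: cop_positions_def)
  have "dct_from (grid n) x y \<le> of_nat (l1 (x ! i) y) + 2 * ennreal (2 * sqrt n)"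
    by (rule order.trans[OF dct_from_le_second_phase[OF n x i y]])
      (intro add_left_mono mult_left_mono first_moment n y l1_le xi; simp)
  also have "\<dots> = ennreal (real (l1 (x ! i) y)) + ennreal (2 * (2 * sqrt n))"
    by (subst ennreal_mult[of 2]) (auto simp: ennreal_of_nat_eq_real_of_nat)
  finally show ?thesis by simp
qed

section \<open>Lower bound for the expected capture time\<close>

text \<open>A cop who captures in round t has travelled at most t, so only the displacement of the
  robber can save time. It is compared with the last sampling time \<open>j * L\<close>; as j
  depends on the path, the sum over all sampling times is used.\<close>

lemma capture_time_ge_initial_distance:
  assumes \<sigma>: "\<sigma> \<in> cop_strategies (grid n) x" and D: "\<And>i. i < length x \<Longrightarrow> D \<le> l1 (x ! i) y"
    and walk: "\<And>t. (Y t, Y (Suc t)) \<in> parcs (grid n)"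
    and t: "Y t \<in> set (cop_trajectory \<sigma> Y t) \<or> (t > 0 \<and> Y (t - 1) \<in> set (cop_trajectory \<sigma> Y t))"
    and L: "L > 0"
  shows "D \<le> t + L + (\<Sum>j\<le>D div L. l1 (Y (j * L)) y)"
proof (cases "D \<le> t")
  case False
  \<comment> \<open>If the cops capture by their own move, the robber is still at
    \<open>Y (t - 1)\<close>.\<close>
  define s where "s = (if Y t \<in> set (cop_trajectory \<sigma> Y t) then t else t - 1)"
  have s: "s \<le> t" "Y s \<in> set (cop_trajectory \<sigma> Y t)" using t by (auto simp: s_def)
  then obtain i where i: "i < length x" "cop_trajectory \<sigma> Y t ! i = Y s"
    by (auto simp: in_set_conv_nth cop_trajectory_legal(2)[OF \<sigma>])
  have walk_l1: "l1 (Y (r + k)) (Y r) \<le> k" for r k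
  proof (induction k)
    case (Suc k)
    have "l1 (Y (r + k)) (Y (Suc (r + k))) = 1" using walk[of "r + k"] by (simp add: parcs_grid_iff)
    with Suc l1_triangle[of "Y (Suc (r + k))" "Y r" "Y (r + k)"] show ?case by (simp add: l1_commute)
  qed simp
  define j where "j = s div L"
  have "s = j * L + s mod L" by (simp add: j_def)
  then have "l1 (Y s) (Y (j * L)) \<le> s mod L" using walk_l1[of "j * L" "s mod L"] by simp
  also have "\<dots> \<le> L" using L by (simp add: less_imp_le)
  finally have 1: "l1 (Y s) (Y (j * L)) \<le> L" .
  have "j \<le> D div L" unfolding j_def using s(1) False by (intro div_le_mono) simp
  then have 2: "l1 (Y (j * L)) y \<le> (\<Sum>j\<le>D div L. l1 (Y (j * L)) y)"
    by (intro member_le_sum) auto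
  have 3: "l1 (x ! i) (Y s) \<le> t" using l1_cop_trajectory[OF \<sigma> i(1), of Y t] i(2) by simp
  show ?thesis
    using D[OF i(1)] l1_triangle[of "x ! i" y "Y s"] l1_triangle[of "Y s" y "Y (j * L)"] 1 2 3 by linarith
qed simp

text \<open>The pathwise bound is integrated with the same error for all strategies; this uniformity
  allows passing to the infimum.\<close>

lemma dct_from_ge:
  assumes n: "n \<ge> 2" and y: "y \<in> pverts (grid n)"
    and D: "\<And>i. i < length x \<Longrightarrow> D \<le> l1 (x ! i) y" "D \<le> 2 * n" and L: "L > 0"
  shows "ennreal (real D) \<le> dct_from (grid n) x y + ennreal (real L + (2 * real n / real L + 1) * (2 * sqrt n))"
    (is "_ \<le> _ + ennreal ?e")
proof -
  let ?M = "random_walk (grid n) y"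
  have "ennreal (real D) - ennreal ?e \<le> (\<integral>\<^sup>+Y. ennreal_of_enat (capture_time (cop_trajectory \<sigma> Y) Y) \<partial>?M)"
    if \<sigma>: "\<sigma> \<in> cop_strategies (grid n) x" for \<sigma>
  proof -
    define F where "F Y = ennreal (real L) + (\<Sum>j\<le>D div L. ennreal (real (l1 (Y (j * L)) y)))" for Y
    have m: "(\<lambda>Y. ennreal (real (l1 (Y t) y))) \<in> borel_measurable ?M" for t
      using borel_measurable_random_walk[of "\<lambda>h. ennreal (real (l1 (last h) y))" "Suc t" "grid n" y]
      by (simp add: last_map)
    have mF: "F \<in> borel_measurable ?M" unfolding F_def using m by (intro borel_measurable_add borel_measurable_sum) auto
    have "(\<integral>\<^sup>+Y. F Y \<partial>?M) = ennreal (real L) + (\<Sum>j\<le>D div L. \<integral>\<^sup>+Y. ennreal (real (l1 (Y (j * L)) y)) \<partial>?M)"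
      unfolding F_def using m by (simp add: nn_integral_add nn_integral_sum del: sum_ennreal)
    also have "\<dots> \<le> ennreal (real L) + (\<Sum>j\<le>D div L. ennreal (2 * sqrt n))"
    proof (intro add_left_mono sum_mono first_moment n y)
      fix j assume "j \<in> {..D div L}"
      then have "j * L \<le> D div L * L" by simp
      also have "\<dots> \<le> D" by (rule div_times_less_eq_dividend)
      finally show "j * L \<le> 2 * n" using D(2) by simp
    qed
    also have "\<dots> = ennreal (real L + (real (D div L) + 1) * (2 * sqrt n))"
      by (simp add: ennreal_of_nat_eq_real_of_nat ennreal_mult[symmetric] ennreal_plus[symmetric] add.commute del: ennreal_plus)
    also have "\<dots> \<le> ennreal ?e"
    proof (intro ennreal_leI add_left_mono mult_right_mono add_right_mono)
      have "real (D div L * L) \<le> real D" by (simp only: of_nat_le_iff div_times_less_eq_dividend)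
      then have "real (D div L) \<le> real D / real L" using L by (simp add: pos_le_divide_eq)
      also have "\<dots> \<le> 2 * real n / real L" using D(2) by (intro divide_right_mono) auto
      finally show "real (D div L) \<le> 2 * real n / real L" .
    qed simp
    finally have F: "(\<integral>\<^sup>+Y. F Y \<partial>?M) \<le> ennreal ?e" .
    have "ennreal (real D) = (\<integral>\<^sup>+Y. ennreal (real D) \<partial>?M)" by simp
    \<comment> \<open>Subtraction in \<open>ennreal\<close> is truncated, so this is strict where F
      exceeds D. Additivity is used only for the measurable F.\<close>
    also have "\<dots> \<le> (\<integral>\<^sup>+Y. (ennreal (real D) - F Y) + F Y \<partial>?M)"
      by (intro nn_integral_mono) (auto simp: diff_add_self_ennreal not_le)
    also have "\<dots> = (\<integral>\<^sup>+Y. ennreal (real D) - F Y \<partial>?M) + (\<integral>\<^sup>+Y. F Y \<partial>?M)"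
      using mF by (intro nn_integral_add) auto
    also have "\<dots> \<le> (\<integral>\<^sup>+Y. ennreal (real D) - F Y \<partial>?M) + ennreal ?e" using F by (rule add_left_mono)
    finally have "ennreal (real D) - ennreal ?e \<le> (\<integral>\<^sup>+Y. ennreal (real D) - F Y \<partial>?M)"
      by (simp add: ennreal_minus_le_iff add.commute)
    also have "\<dots> \<le> (\<integral>\<^sup>+Y. ennreal_of_enat (capture_time (cop_trajectory \<sigma> Y) Y) \<partial>?M)"
    proof (rule nn_integral_mono_AE, use AE_grid_walk[OF n y] in eventually_elim)
      case (elim Y)
      show ?case
      proof (cases "capture_time (cop_trajectory \<sigma> Y) Y")
        case (enat t)
        let ?T = "{t. Y t \<in> set (cop_trajectory \<sigma> Y t) \<or> (t > 0 \<and> Y (t - 1) \<in> set (cop_trajectory \<sigma> Y t))}"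
        have "enat ` ?T \<noteq> {}"
        proof
          assume "enat ` ?T = {}"
          then have "capture_time (cop_trajectory \<sigma> Y) Y = top"
            unfolding capture_time_def by (simp only: Inf_empty)
          with enat show False by (simp add: top_enat_def)
        qed
        then have "capture_time (cop_trajectory \<sigma> Y) Y \<in> enat ` ?T"
          unfolding capture_time_def by (metis (no_types, lifting) Inf_enat_def LeastI ex_in_conv)
        then have "t \<in> ?T" using enat by auto
        then have "D \<le> t + L + (\<Sum>j\<le>D div L. l1 (Y (j * L)) y)"
          using elim by (intro capture_time_ge_initial_distance[OF \<sigma> D(1) _ _ L]) auto
        then have "real D \<le> real (t + L + (\<Sum>j\<le>D div L. l1 (Y (j * L)) y))" by (simp only: of_nat_le_iff)
        then have "ennreal (real D) \<le> ennreal (real t + (real L + (\<Sum>j\<le>D div L. real (l1 (Y (j * L)) y))))"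
          by (intro ennreal_leI) simp
        also have "\<dots> = ennreal (real t) + F Y"
          by (simp add: F_def sum_nonneg)
        finally have "ennreal (real D) \<le> ennreal (real t) + F Y" .
        then show ?thesis
          by (simp add: enat ennreal_minus_le_iff add.commute ennreal_of_nat_eq_real_of_nat)
      qed simp
    qed
    finally show ?thesis .
  qed
  then have "ennreal (real D) - ennreal ?e \<le> dct_from (grid n) x y"
    unfolding dct_from_def by (rule INF_greatest)
  then show ?thesis by (simp add: ennreal_minus_le_iff add.commute)
qed

section \<open>Averaging over the initial vertex\<close>

lemma sum_pverts_grid: "(\<Sum>u\<in>pverts (grid n). f u) = (\<Sum>y<n. \<Sum>x<n. f (x, y))"
proof -
  have "pverts (grid n) = {..<n} \<times> {..<n}" by (auto simp: pverts_grid_iff)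
  then have "(\<Sum>u\<in>pverts (grid n). f u) = (\<Sum>x<n. \<Sum>y<n. f (x, y))"
    by (simp add: sum.cartesian_product)
  also have "\<dots> = (\<Sum>y<n. \<Sum>x<n. f (x, y))" by (rule sum.swap)
  finally show ?thesis .
qed

lemma card_pverts_grid: "card (pverts (grid n)) = n\<^sup>2"
  using sum_pverts_grid[of "\<lambda>_. 1 :: nat" n] by (simp add: power2_eq_square)

lemma sum_min_l1:
  "(\<Sum>u\<in>pverts (grid n). real (min (l1 p u) (l1 q u))) =
    median_cost n (real (fst p), real (snd p)) (real (fst q), real (snd q))"
proof -
  have l1: "real (l1 p (x, y)) = \<bar>real x - real (fst p)\<bar> + \<bar>real y - real (snd p)\<bar>" for p x y
    by (simp add: l1_def abs_minus_commute)
  show ?thesis by (simp only: sum_pverts_grid median_cost_def of_nat_min l1 fst_conv snd_conv)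
qed

lemma dct_grid_ge:
  assumes n: "n \<ge> 2" and L: "L > 0"
  shows "ennreal (3 / 8 * real n - 5 / 2 - (real L + (2 * real n / real L + 1) * (2 * sqrt n))) \<le> dct (grid n)"
    (is "ennreal (_ - ?e) \<le> _")
  unfolding dct_def cop_number_grid[OF n] dct_k_def
proof (rule INF_greatest)
  fix x assume x: "x \<in> cop_positions (grid n) 2"
  then obtain p q where pq: "x = [p, q]" "p \<in> pverts (grid n)" "q \<in> pverts (grid n)"
    by (auto simp: cop_positions_def length_Suc_conv numeral_2_eq_2)
  let ?S = "\<Sum>y\<in>pverts (grid n). dct_from (grid n) x y"
  have e: "?e \<ge> 0" by simp
  have eq: "3 / 8 * real n ^ 3 - 5 / 2 * (real n)\<^sup>2 - (real n)\<^sup>2 * e = (3 / 8 * real n - 5 / 2 - e) * (real n)\<^sup>2" for e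
    by (simp add: power2_eq_square power3_eq_cube algebra_simps)
  have "3 / 8 * real n ^ 3 - 5 / 2 * (real n)\<^sup>2 \<le>
      (\<Sum>u\<in>pverts (grid n). real (min (l1 p u) (l1 q u)))"
    unfolding sum_min_l1 using n pq(2,3) by (intro median_cost_ge) (auto simp: pverts_grid_iff)
  then have "ennreal (3 / 8 * real n ^ 3 - 5 / 2 * (real n)\<^sup>2) \<le>
      ennreal (\<Sum>u\<in>pverts (grid n). real (min (l1 p u) (l1 q u)))" by (rule ennreal_leI)
  also have "\<dots> = (\<Sum>u\<in>pverts (grid n). ennreal (real (min (l1 p u) (l1 q u))))"
    by (rule sum_ennreal[symmetric]) simp
  also have "\<dots> \<le> (\<Sum>u\<in>pverts (grid n). dct_from (grid n) x u + ennreal ?e)"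
  proof (rule sum_mono)
    fix u assume u: "u \<in> pverts (grid n)"
    show "ennreal (real (min (l1 p u) (l1 q u))) \<le> dct_from (grid n) x u + ennreal ?e"
    proof (rule dct_from_ge[OF n u _ _ L])
      show "min (l1 p u) (l1 q u) \<le> l1 (x ! i) u" if "i < length x" for i
        using that by (auto simp: pq less_Suc_eq)
      show "min (l1 p u) (l1 q u) \<le> 2 * n" using l1_le[OF pq(2) u] by simp
    qed
  qed
  also have "\<dots> = ?S + ennreal ((real n)\<^sup>2 * ?e)"
    using e by (simp add: sum.distrib card_pverts_grid ennreal_mult ennreal_of_nat_eq_real_of_nat del: ennreal_plus)
  finally have "ennreal (3 / 8 * real n ^ 3 - 5 / 2 * (real n)\<^sup>2) - ennreal ((real n)\<^sup>2 * ?e) \<le> ?S"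
    by (simp add: ennreal_minus_le_iff add.commute del: ennreal_plus)
  then have "ennreal (3 / 8 * real n ^ 3 - 5 / 2 * (real n)\<^sup>2 - (real n)\<^sup>2 * ?e) \<le> ?S"
    using e by (subst (asm) ennreal_minus) simp_all
  then have "ennreal (3 / 8 * real n ^ 3 - 5 / 2 * (real n)\<^sup>2 - (real n)\<^sup>2 * ?e) / of_nat (card (pverts (grid n)))
      \<le> ?S / of_nat (card (pverts (grid n)))" by (rule divide_right_mono_ennreal)
  moreover have "ennreal (3 / 8 * real n - 5 / 2 - ?e) =
      ennreal (3 / 8 * real n ^ 3 - 5 / 2 * (real n)\<^sup>2 - (real n)\<^sup>2 * ?e) / of_nat (card (pverts (grid n)))"
  \<comment> \<open>The bound may be negative, for instance for small n; then \<open>ennreal\<close>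
    sends both sides to 0.\<close>
  proof (cases "3 / 8 * real n - 5 / 2 - ?e \<ge> 0")
    case True
    have "ennreal ((3 / 8 * real n - 5 / 2 - ?e) * (real n)\<^sup>2) / ennreal ((real n)\<^sup>2) =
        ennreal ((3 / 8 * real n - 5 / 2 - ?e) * (real n)\<^sup>2 / (real n)\<^sup>2)"
      using n by (intro divide_ennreal mult_nonneg_nonneg True) auto
    then show ?thesis using n unfolding eq card_pverts_grid ennreal_of_nat_eq_real_of_nat by simp
  next
    case False
    have "(3 / 8 * real n - 5 / 2 - ?e) * (real n)\<^sup>2 \<le> 0"
      using False by (intro mult_nonpos_nonneg) auto
    with False show ?thesis unfolding eq by (simp only: ennreal_neg ennreal_zero_divide not_le less_imp_le)
  qed
  ultimately show "ennreal (3 / 8 * real n - 5 / 2 - ?e) \<le> ?S / of_nat (card (pverts (grid n)))" by simp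
qed

lemma dct_grid_le:
  assumes n: "n \<ge> 2"
  shows "dct (grid n) \<le> ennreal (3 / 8 * real n + 7 + 4 * sqrt n)"
proof -
  define p q where "p = (n div 4, n div 2)" and "q = (3 * n div 4, n div 2)"
  have x: "[p, q] \<in> cop_positions (grid n) 2"
    using n by (auto simp: cop_positions_def p_def q_def pverts_grid_iff)
  have "(\<Sum>u\<in>pverts (grid n). dct_from (grid n) [p, q] u) \<le>
      (\<Sum>u\<in>pverts (grid n). ennreal (real (min (l1 p u) (l1 q u)) + 4 * sqrt n))"
  proof (rule sum_mono)
    fix u assume u: "u \<in> pverts (grid n)"
    show "dct_from (grid n) [p, q] u \<le> ennreal (real (min (l1 p u) (l1 q u)) + 4 * sqrt n)"
      using dct_from_le[OF n x _ u, of 0] dct_from_le[OF n x _ u, of 1] by (simp add: min_def)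
  qed
  also have "\<dots> = ennreal (\<Sum>u\<in>pverts (grid n). real (min (l1 p u) (l1 q u)) + 4 * sqrt n)"
    by (rule sum_ennreal) simp
  also have "\<dots> \<le> ennreal (3 / 8 * real n ^ 3 + 7 * (real n)\<^sup>2 + (real n)\<^sup>2 * (4 * sqrt n))"
    unfolding sum.distrib sum_min_l1 using median_cost_le[of n] n
    by (intro ennreal_leI) (simp add: p_def q_def card_pverts_grid)
  finally have "(\<Sum>u\<in>pverts (grid n). dct_from (grid n) [p, q] u) / of_nat (card (pverts (grid n))) \<le>
      ennreal (3 / 8 * real n ^ 3 + 7 * (real n)\<^sup>2 + (real n)\<^sup>2 * (4 * sqrt n)) / of_nat (card (pverts (grid n)))"
    by (rule divide_right_mono_ennreal)
  also have "\<dots> = ennreal ((3 / 8 * real n ^ 3 + 7 * (real n)\<^sup>2 + (real n)\<^sup>2 * (4 * sqrt n)) / (real n)\<^sup>2)"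
    unfolding card_pverts_grid ennreal_of_nat_eq_real_of_nat of_nat_power
    using n by (intro divide_ennreal) auto
  also have "(3 / 8 * real n ^ 3 + 7 * (real n)\<^sup>2 + (real n)\<^sup>2 * (4 * sqrt n)) / (real n)\<^sup>2 = 3 / 8 * real n + 7 + 4 * sqrt n"
    using n by (simp add: field_simps power2_eq_square power3_eq_cube)
  finally show ?thesis
    unfolding dct_def cop_number_grid[OF n] dct_k_def by (rule INF_lower2[OF x])
qed

section \<open>Passage to the limit\<close>

lemma tendsto_dct_grid: "(\<lambda>n. enn2real (dct (grid n)) / real n) \<longlonglongrightarrow> 3 / 8"
proof (rule tendsto_sandwich)
  \<comment> \<open>The error of the lower bound for L = n^(3/4) rounded up; the first summand 1
    pays for the rounding. Altogether it is of order n^(3/4).\<close>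
  define e where "e n = real n powr (3 / 4) + 1 + (2 * real n / real n powr (3 / 4) + 1) * (2 * sqrt (real n))" for n :: nat
  have lower: "3 / 8 * real n - 5 / 2 - e n \<le> enn2real (dct (grid n))" if n: "n \<ge> 2" for n
  proof -
    define L where "L = nat \<lceil>real n powr (3 / 4)\<rceil>"
    have pos: "real n powr (3 / 4) > 0" using n by simp
    then have L: "real n powr (3 / 4) \<le> real L" "real L \<le> real n powr (3 / 4) + 1" "L > 0"
      unfolding L_def by (linarith, linarith, simp)
    have "2 * real n / real L \<le> 2 * real n / real n powr (3 / 4)"
      using mult_pos_pos[of "real L" "real n powr (3 / 4)"] L(3) pos by (intro divide_left_mono L(1)) auto
    then have "real L + (2 * real n / real L + 1) * (2 * sqrt n) \<le> e n"
      unfolding e_def using L(2) by (intro add_mono mult_right_mono) auto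
    then have "ennreal (3 / 8 * real n - 5 / 2 - e n) \<le>
        ennreal (3 / 8 * real n - 5 / 2 - (real L + (2 * real n / real L + 1) * (2 * sqrt n)))"
      by (intro ennreal_leI) simp
    also have "\<dots> \<le> dct (grid n)" by (rule dct_grid_ge[OF n L(3)])
    finally have "enn2real (ennreal (3 / 8 * real n - 5 / 2 - e n)) \<le> enn2real (dct (grid n))"
      using dct_grid_le[OF n] by (intro enn2real_mono) (auto intro: le_less_trans)
    then have "3 / 8 * real n - 5 / 2 - e n \<le> enn2real (dct (grid n))"
      if "3 / 8 * real n - 5 / 2 - e n \<ge> 0" using that by simp
    then show ?thesis using enn2real_nonneg[of "dct (grid n)"] by linarith
  qed
  show "\<forall>\<^sub>F n in sequentially. (3 / 8 * real n - 5 / 2 - e n) / real n \<le> enn2real (dct (grid n)) / real n"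
    using eventually_ge_at_top[of 2] by eventually_elim (intro divide_right_mono lower, auto)
  show "\<forall>\<^sub>F n in sequentially. enn2real (dct (grid n)) / real n \<le> (3 / 8 * real n + 7 + 4 * sqrt n) / real n"
    using eventually_ge_at_top[of 2]
    by eventually_elim (intro divide_right_mono enn2real_leI dct_grid_le, auto)
  show "(\<lambda>n. (3 / 8 * real n - 5 / 2 - e n) / real n) \<longlonglongrightarrow> 3 / 8"
    unfolding e_def by real_asymp
  show "(\<lambda>n. (3 / 8 * real n + 7 + 4 * sqrt (real n)) / real n) \<longlonglongrightarrow> 3 / 8"
    by real_asymp
qed

lemma tendsto_ct_grid: "(\<lambda>n. real (the_enat (ct (grid n))) / real n) \<longlonglongrightarrow> 1"
proof (rule tendsto_sandwich)
  have ct: "real n - 3 \<le> real (the_enat (ct (grid n)))" "real (the_enat (ct (grid n))) \<le> real n + 5" if "n \<ge> 2" for n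
    using ct_grid_bounds[OF that] by (cases "ct (grid n)"; simp)+
  show "\<forall>\<^sub>F n in sequentially. (real n - 3) / real n \<le> real (the_enat (ct (grid n))) / real n"
    using eventually_ge_at_top[of 2] by eventually_elim (intro divide_right_mono ct, auto)
  show "\<forall>\<^sub>F n in sequentially. real (the_enat (ct (grid n))) / real n \<le> (real n + 5) / real n"
    using eventually_ge_at_top[of 2] by eventually_elim (intro divide_right_mono ct, auto)
qed real_asymp+

theorem theorem3p5:
  shows "(\<lambda>n. enn2real (dct (grid n))) \<sim>[at_top] (\<lambda>n. 3 / 8 * real n) \<and>
    (\<lambda>n. cost_of_drunkenness (grid n)) \<longlonglongrightarrow> ennreal (8 / 3)"
proof
  have "(\<lambda>n. enn2real (dct (grid n)) / real n / (3 / 8)) \<longlonglongrightarrow> (3 / 8) / (3 / 8)"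
    by (intro tendsto_divide tendsto_dct_grid) auto
  then show "(\<lambda>n. enn2real (dct (grid n))) \<sim>[at_top] (\<lambda>n. 3 / 8 * real n)"
    by (intro asymp_equivI') (simp add: field_simps)
  \<comment> \<open>Both times are scaled by n, so that numerator and denominator converge
    separately.\<close>
  have lim: "(\<lambda>n. ennreal ((real (the_enat (ct (grid n))) / real n) / (enn2real (dct (grid n)) / real n))) \<longlonglongrightarrow> ennreal (1 / (3 / 8))"
    by (intro tendsto_ennrealI tendsto_divide tendsto_dct_grid tendsto_ct_grid) auto
  have "\<forall>\<^sub>F n in sequentially. enn2real (dct (grid n)) / real n > 0"
    by (rule order_tendstoD[OF tendsto_dct_grid]) simp
  \<comment> \<open>The quotients in the reals and in \<open>ennreal\<close> agree once both times
    are finite and the denominator is positive.\<close>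
  then have ev: "\<forall>\<^sub>F n in sequentially. ennreal ((real (the_enat (ct (grid n))) / real n) / (enn2real (dct (grid n)) / real n)) =
      cost_of_drunkenness (grid n)"
    using eventually_ge_at_top[of 2]
  proof eventually_elim
    case (elim n)
    then have pos: "enn2real (dct (grid n)) > 0" by (simp add: zero_less_divide_iff)
    have "dct (grid n) < top" using dct_grid_le[OF elim(2)] by (auto intro: le_less_trans)
    then have dct: "dct (grid n) = ennreal (enn2real (dct (grid n)))" by simp
    obtain c where c: "ct (grid n) = enat c" using ct_grid_bounds(2)[OF elim(2)] by (cases "ct (grid n)") auto
    have "cost_of_drunkenness (grid n) = ennreal (real c) / ennreal (enn2real (dct (grid n)))"
      unfolding cost_of_drunkenness_def dct[symmetric] by (simp add: c ennreal_of_nat_eq_real_of_nat)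
    also have "\<dots> = ennreal (real c / enn2real (dct (grid n)))"
      using pos by (intro divide_ennreal) auto
    finally show ?case using elim by (simp add: c)
  qed
  show "(\<lambda>n. cost_of_drunkenness (grid n)) \<longlonglongrightarrow> ennreal (8 / 3)"
    using Lim_transform_eventually[OF lim ev] by simp
qed

end
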